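(* Let $M$ be a manifold of dimension $n\ge 2$, let $\widetilde{\mathbf G}$ be a locally Minkowski spray on $M$, and let $\mathbf G$ be a spray on $M$ that is pointwise projectively related to $\widetilde{\mathbf G}$, that is, $$G^i=\widetilde G^i+Py^i ,$$ where $P=P(x,y)$ is the projective factor. Suppose that $\mathbf G$ is weakly Ricci constant ($Ric_{;0}=0$) or of constant curvature. Then along any geodesic $x=x(s)$ of $\mathbf G$ (with $s$ a geodesic parameter of $\mathbf G$), the function $P(s):=P(x(s),x'(s))$ is given by one of the following cases: $$P(s)=\frac{1}{s+\kappa},\qquad P(s)=-c\tan(cs+\kappa),\qquad P(s)=-\frac{c(1-\kappa e^{2cs})}{1+\kappa e^{2cs}},$$ where $c,\kappa$ are constants (along the geodesic). Further, if $\mathbf G$ is complete, then $P(s)$ is given by $$P(s)=-\frac{c(1-\kappa e^{2cs})}{1+\kappa e^{2cs}} .$$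
   Context: A spray $\mathbf G$ on an $n$-dimensional manifold $M$ is a smooth vector field on a conical region $\mathcal C$ of $TM\setminus\{0\}$ (possibly $\mathcal C=TM\setminus\{0\}$) of the form $\mathbf G=y^i\frac{\partial}{\partial x^i}-2G^i\frac{\partial}{\partial y^i}$ in local coordinates $(x^i,y^i)$ of $TM$, where $G^i(x,\lambda y)=\lambda^2G^i(x,y)$ for $\lambda>0$. Its geodesics are the projections to $M$ of its integral curves, i.e. the curves satisfying $\frac{d^2x^i}{ds^2}+2G^i(x,\frac{dx}{ds})=0$; such an $s$ is called a geodesic parameter. $\mathbf G$ is complete if every geodesic extends to a geodesic defined for all $s\in(-\infty,+\infty)$. Two sprays $\mathbf G,\bar{\mathbf G}$ are pointwise projectively related if $\bar G^i=G^i+Py^i$ for a function $P$ on $\mathcal C$ (then $P$ is positively homogeneous of degree one in $y$). A spray $\widetilde{\mathbf G}$ is locally Minkowski if near each point there are local coordinates in which $\widetilde G^i=0$, so that its geodesics are locally straight lines. With $\partial_k=\partial/\partial x^k$, $\dot\partial_k=\partial/\partial y^k$, the Riemann curvature of $\mathbf G$ is $$R^i{}_k=2\partial_kG^i-y^j(\partial_j\dot\partial_kG^i)+2G^j(\dot\partial_j\dot\partial_kG^i)-(\dot\partial_jG^i)(\dot\partial_kG^j),$$ and $Ric=R^i{}_i$. Horizontal derivatives with respect to the Berwald connection: $f_{;j}=\delta_jf$ for functions $f$ on $\mathcal C$, and $T_{i;j}=\delta_jT_i-T_rG^r_{ij}$ for $T=T_idx^i$, where $\delta_i=\partial_i-G^r_i\dot\partial_r$,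 $G^r_i=\dot\partial_iG^r$, $G^k_{ir}=\dot\partial_r\dot\partial_iG^k$. $\mathbf G$ is weakly Ricci constant if $Ric_{;0}:=Ric_{;r}y^r=0$. $\mathbf G$ is of constant curvature if $R^i{}_k=R\,\delta^i_k-\tau_ky^i$ for some function $R$ and covector $\tau_k$ on $\mathcal C$ with $\tau_{i;k}=0$. *)

theory Defs
  imports "HOL-Analysis.Analysis"
begin

section \<open>Smooth maps between Euclidean spaces\<close>

text \<open>Only meant for open sets \<open>S\<close>; all partial derivatives of order at most \<open>k\<close> exist as
  iterated derivatives along the standard basis and are continuous.\<close>

primrec Ck_on :: "nat \<Rightarrow> ('a::euclidean_space \<Rightarrow> 'b::real_normed_vector) \<Rightarrow> 'a set \<Rightarrow> bool" where
  "Ck_on 0 f S \<longleftrightarrow> continuous_on S f"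
| "Ck_on (Suc k) f S \<longleftrightarrow> (\<forall>x\<in>S. f differentiable (at x)) \<and>
     (\<forall>b\<in>Basis. Ck_on k (\<lambda>x. frechet_derivative f (at x) b) S)"

definition smooth_on :: "('a::euclidean_space \<Rightarrow> 'b::real_normed_vector) \<Rightarrow> 'a set \<Rightarrow> bool" where
  "smooth_on f S \<longleftrightarrow> (\<forall>k. Ck_on k f S)"


section \<open>Smooth manifolds\<close>

text \<open>A chart is a pair of its domain and its coordinate map (irrelevant outside the domain).
  The model space \<open>'e\<close> is kept general so that the tangent bundle, modelled on \<open>'e \<times> 'e\<close>, is
  covered by the same definitions.\<close>

type_synonym ('p, 'e) chart = "'p set \<times> ('p \<Rightarrow> 'e)"

definition chart_inv :: "('p, 'e) chart \<Rightarrow> 'e \<Rightarrow> 'p" where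
  "chart_inv c = inv_into (fst c) (snd c)"

definition transition :: "('p, 'e) chart \<Rightarrow> ('p, 'e) chart \<Rightarrow> 'e \<Rightarrow> 'e" where
  "transition c d = snd d \<circ> chart_inv c"

definition is_chart :: "'p set \<Rightarrow> ('p, 'e::euclidean_space) chart \<Rightarrow> bool" where
  "is_chart M c \<longleftrightarrow> fst c \<subseteq> M \<and> inj_on (snd c) (fst c) \<and> open (snd c ` fst c)"

definition compatible :: "('p, 'e::euclidean_space) chart \<Rightarrow> ('p, 'e) chart \<Rightarrow> bool" where
  "compatible c d \<longleftrightarrow>
     open (snd c ` (fst c \<inter> fst d)) \<and> open (snd d ` (fst c \<inter> fst d)) \<and>
     smooth_on (transition c d) (snd c ` (fst c \<inter> fst d)) \<and>
     smooth_on (transition d c) (snd d ` (fst c \<inter> fst d))"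

definition smooth_atlas :: "'p set \<Rightarrow> ('p, 'e::euclidean_space) chart set \<Rightarrow> bool" where
  "smooth_atlas M A \<longleftrightarrow> (\<forall>c\<in>A. is_chart M c) \<and> (\<Union>c\<in>A. fst c) = M \<and>
     (\<forall>c\<in>A. \<forall>d\<in>A. compatible c d)"

definition atlas_topology :: "'p set \<Rightarrow> ('p, 'e::euclidean_space) chart set \<Rightarrow> 'p topology" where
  "atlas_topology M A = topology (\<lambda>W. W \<subseteq> M \<and> (\<forall>c\<in>A. open (snd c ` (W \<inter> fst c))))"

lemma openin_atlas_topology:
  assumes "smooth_atlas M A"
  shows "openin (atlas_topology M A) W \<longleftrightarrow> W \<subseteq> M \<and> (\<forall>c\<in>A. open (snd c ` (W \<inter> fst c)))"
proof -
  have "istopology (\<lambda>W. W \<subseteq> M \<and> (\<forall>c\<in>A. open (snd c ` (W \<inter> fst c))))"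
    unfolding istopology_def
  proof (intro conjI allI impI ballI)
    fix S T c
    assume S: "S \<subseteq> M \<and> (\<forall>c\<in>A. open (snd c ` (S \<inter> fst c)))"
      and T: "T \<subseteq> M \<and> (\<forall>c\<in>A. open (snd c ` (T \<inter> fst c)))" and c: "c \<in> A"
    have inj: "inj_on (snd c) (fst c)"
      using assms c by (auto simp: smooth_atlas_def is_chart_def)
    have "snd c ` (S \<inter> T \<inter> fst c) = snd c ` ((S \<inter> fst c) \<inter> (T \<inter> fst c))"
      by (rule arg_cong[where f = "image (snd c)"]) auto
    also have "\<dots> = snd c ` (S \<inter> fst c) \<inter> snd c ` (T \<inter> fst c)"
      by (rule inj_on_image_Int[OF inj]) auto
    finally show "open (snd c ` (S \<inter> T \<inter> fst c))"
      using S T c by auto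
  next
    fix K c
    assume K: "\<forall>S\<in>K. S \<subseteq> M \<and> (\<forall>c\<in>A. open (snd c ` (S \<inter> fst c)))" and c: "c \<in> A"
    have "snd c ` (\<Union>K \<inter> fst c) = (\<Union>S\<in>K. snd c ` (S \<inter> fst c))"
      by auto
    then show "open (snd c ` (\<Union>K \<inter> fst c))"
      using K c by auto
  qed auto
  then show ?thesis
    by (simp add: atlas_topology_def topology_inverse')
qed

text \<open>The atlas is required to be maximal, so that its members are exactly the local coordinate
  systems of the manifold. The dimension is that of \<open>'e\<close>.\<close>

definition smooth_manifold :: "'p set \<Rightarrow> ('p, 'e::euclidean_space) chart set \<Rightarrow> bool" where
  "smooth_manifold M A \<longleftrightarrow> smooth_atlas M A \<and>
     (\<forall>c. is_chart M c \<and> (\<forall>d\<in>A. compatible c d) \<longrightarrow> c \<in> A) \<and>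
     Hausdorff_space (atlas_topology M A) \<and> second_countable (atlas_topology M A)"


section \<open>Tangent vectors, tangent bundle, vector fields\<close>

text \<open>A tangent vector at \<open>p\<close> is the family of its components in all charts around \<open>p\<close>, related by
  the Jacobians of the coordinate changes; components in charts not containing \<open>p\<close> are set to 0.\<close>

type_synonym ('p, 'e) comps = "('p, 'e) chart \<Rightarrow> 'e"

definition tangent_space :: "('p, 'e::euclidean_space) chart set \<Rightarrow> 'p \<Rightarrow> ('p, 'e) comps set" where
  "tangent_space A p = {v.
     (\<forall>c. c \<notin> A \<or> p \<notin> fst c \<longrightarrow> v c = 0) \<and>
     (\<forall>c\<in>A. \<forall>d\<in>A. p \<in> fst c \<inter> fst d \<longrightarrow>
        v d = frechet_derivative (transition c d) (at (snd c p)) (v c))}"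

type_synonym ('p, 'e) tvec = "'p \<times> ('p, 'e) comps"

definition tangent_bundle :: "'p set \<Rightarrow> ('p, 'e::euclidean_space) chart set \<Rightarrow> ('p, 'e) tvec set" where
  "tangent_bundle M A = Sigma M (tangent_space A)"

text \<open>The coordinates \<open>(x, y)\<close> of \<open>TM\<close> induced by a chart of \<open>M\<close>.\<close>

definition tangent_chart ::
  "'p set \<Rightarrow> ('p, 'e::euclidean_space) chart set \<Rightarrow> ('p, 'e) chart \<Rightarrow> (('p, 'e) tvec, 'e \<times> 'e) chart" where
  "tangent_chart M A c =
     ({w \<in> tangent_bundle M A. fst w \<in> fst c}, \<lambda>w. (snd c (fst w), snd w c))"

definition tangent_atlas ::
  "'p set \<Rightarrow> ('p, 'e::euclidean_space) chart set \<Rightarrow> (('p, 'e) tvec, 'e \<times> 'e) chart set" where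
  "tangent_atlas M A = tangent_chart M A ` A"

definition vector_field_on ::
  "('p, 'e::euclidean_space) chart set \<Rightarrow> 'p set \<Rightarrow> ('p \<Rightarrow> ('p, 'e) comps) \<Rightarrow> bool" where
  "vector_field_on A W X \<longleftrightarrow> (\<forall>p\<in>W. X p \<in> tangent_space A p) \<and>
     (\<forall>c\<in>A. smooth_on (\<lambda>x. X (chart_inv c x) c) (snd c ` (W \<inter> fst c)))"

text \<open>Curves are always considered on open intervals \<open>I\<close>.\<close>

definition differentiable_curve ::
  "'p set \<Rightarrow> ('p, 'e::euclidean_space) chart set \<Rightarrow> real set \<Rightarrow> (real \<Rightarrow> 'p) \<Rightarrow> bool" where
  "differentiable_curve M A I \<gamma> \<longleftrightarrow>
     continuous_map (top_of_set I) (atlas_topology M A) \<gamma> \<and>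
     (\<forall>s\<in>I. \<forall>c\<in>A. \<gamma> s \<in> fst c \<longrightarrow> (snd c \<circ> \<gamma>) differentiable (at s))"

definition velocity ::
  "('p, 'e::euclidean_space) chart set \<Rightarrow> (real \<Rightarrow> 'p) \<Rightarrow> real \<Rightarrow> ('p, 'e) comps" where
  "velocity A \<gamma> s =
     (\<lambda>c. if c \<in> A \<and> \<gamma> s \<in> fst c then vector_derivative (snd c \<circ> \<gamma>) (at s) else 0)"

definition integral_curve ::
  "'p set \<Rightarrow> ('p, 'e::euclidean_space) chart set \<Rightarrow> 'p set \<Rightarrow> ('p \<Rightarrow> ('p, 'e) comps) \<Rightarrow>
   real set \<Rightarrow> (real \<Rightarrow> 'p) \<Rightarrow> bool" where
  "integral_curve M A W X I \<gamma> \<longleftrightarrow> differentiable_curve M A I \<gamma> \<and>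
     (\<forall>s\<in>I. \<gamma> s \<in> W \<and> velocity A \<gamma> s = X (\<gamma> s))"


section \<open>Sprays\<close>

definition conical_region ::
  "'p set \<Rightarrow> ('p, 'e::euclidean_space) chart set \<Rightarrow> ('p, 'e) tvec set \<Rightarrow> bool" where
  "conical_region M A C \<longleftrightarrow>
     C \<subseteq> {w \<in> tangent_bundle M A. snd w \<noteq> (\<lambda>c. 0)} \<and>
     openin (atlas_topology (tangent_bundle M A) (tangent_atlas M A)) C \<and>
     (\<forall>w\<in>C. \<forall>t>0. (fst w, \<lambda>c. t *\<^sub>R snd w c) \<in> C)"

definition region_in ::
  "'p set \<Rightarrow> ('p, 'e::euclidean_space) chart set \<Rightarrow> ('p, 'e) tvec set \<Rightarrow> ('p, 'e) chart \<Rightarrow> ('e \<times> 'e) set" where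
  "region_in M A C c = snd (tangent_chart M A c) ` (C \<inter> fst (tangent_chart M A c))"

definition fun_in ::
  "'p set \<Rightarrow> ('p, 'e::euclidean_space) chart set \<Rightarrow> (('p, 'e) tvec \<Rightarrow> 'b) \<Rightarrow> ('p, 'e) chart \<Rightarrow> 'e \<times> 'e \<Rightarrow> 'b" where
  "fun_in M A f c z = f (chart_inv (tangent_chart M A c) z)"

text \<open>Vector fields on \<open>TM\<close> in the sense of the definitions above, with \<open>TM\<close> in place of \<open>M\<close>.\<close>

type_synonym ('p, 'e) tm_field = "('p, 'e) tvec \<Rightarrow> (('p, 'e) tvec, 'e \<times> 'e) comps"

text \<open>The coefficients \<open>G\<^sup>i(x, y)\<close> in \<open>y\<^sup>i \<partial>/\<partial>x\<^sup>i - 2 G\<^sup>i \<partial>/\<partial>y\<^sup>i\<close>.\<close>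

definition spray_coeff ::
  "'p set \<Rightarrow> ('p, 'e::euclidean_space) chart set \<Rightarrow> ('p, 'e) tm_field \<Rightarrow> ('p, 'e) chart \<Rightarrow> 'e \<times> 'e \<Rightarrow> 'e" where
  "spray_coeff M A X c z = - (1/2) *\<^sub>R snd (fun_in M A X c z (tangent_chart M A c))"

definition spray ::
  "'p set \<Rightarrow> ('p, 'e::euclidean_space) chart set \<Rightarrow> ('p, 'e) tvec set \<Rightarrow> ('p, 'e) tm_field \<Rightarrow> bool" where
  "spray M A C X \<longleftrightarrow> conical_region M A C \<and> vector_field_on (tangent_atlas M A) C X \<and>
     (\<forall>c\<in>A. \<forall>(x, y) \<in> region_in M A C c.
        fst (fun_in M A X c (x, y) (tangent_chart M A c)) = y \<and>
        (\<forall>t>0. spray_coeff M A X c (x, t *\<^sub>R y) = t\<^sup>2 *\<^sub>R spray_coeff M A X c (x, y)))"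

definition geodesic ::
  "'p set \<Rightarrow> ('p, 'e::euclidean_space) chart set \<Rightarrow> ('p, 'e) tvec set \<Rightarrow> ('p, 'e) tm_field \<Rightarrow>
   real set \<Rightarrow> (real \<Rightarrow> 'p) \<Rightarrow> bool" where
  "geodesic M A C X I \<gamma> \<longleftrightarrow> open I \<and> is_interval I \<and> I \<noteq> {} \<and>
     (\<exists>\<sigma>. integral_curve (tangent_bundle M A) (tangent_atlas M A) C X I \<sigma> \<and>
          (\<forall>s\<in>I. \<gamma> s = fst (\<sigma> s)))"

definition complete_spray ::
  "'p set \<Rightarrow> ('p, 'e::euclidean_space) chart set \<Rightarrow> ('p, 'e) tvec set \<Rightarrow> ('p, 'e) tm_field \<Rightarrow> bool" where
  "complete_spray M A C X \<longleftrightarrow> (\<forall>I \<gamma>. geodesic M A C X I \<gamma> \<longrightarrow>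
     (\<exists>\<gamma>'. geodesic M A C X UNIV \<gamma>' \<and> (\<forall>s\<in>I. \<gamma>' s = \<gamma> s)))"

definition locally_Minkowski ::
  "'p set \<Rightarrow> ('p, 'e::euclidean_space) chart set \<Rightarrow> ('p, 'e) tvec set \<Rightarrow> ('p, 'e) tm_field \<Rightarrow> bool" where
  "locally_Minkowski M A C X \<longleftrightarrow> spray M A C X \<and>
     (\<forall>p\<in>M. \<exists>c\<in>A. p \<in> fst c \<and> (\<forall>z \<in> region_in M A C c. spray_coeff M A X c z = 0))"

text \<open>\<open>projectively_related M A C X Y P\<close>: the coefficients of \<open>Y\<close> are those of \<open>X\<close> plus \<open>P y\<^sup>i\<close>.\<close>

definition projectively_related ::
  "'p set \<Rightarrow> ('p, 'e::euclidean_space) chart set \<Rightarrow> ('p, 'e) tvec set \<Rightarrow>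
   ('p, 'e) tm_field \<Rightarrow> ('p, 'e) tm_field \<Rightarrow> (('p, 'e) tvec \<Rightarrow> real) \<Rightarrow> bool" where
  "projectively_related M A C X Y P \<longleftrightarrow> (\<forall>c\<in>A. \<forall>z \<in> region_in M A C c.
     spray_coeff M A Y c z = spray_coeff M A X c z + fun_in M A P c z *\<^sub>R snd z)"


section \<open>Curvature in local coordinates\<close>

text \<open>\<open>dx k\<close> and \<open>dy k\<close> are \<open>\<partial>/\<partial>x\<^sup>k\<close> and \<open>\<partial>/\<partial>y\<^sup>k\<close>.\<close>

definition dx :: "'n \<Rightarrow> ((real^'n) \<times> (real^'n) \<Rightarrow> real) \<Rightarrow> (real^'n) \<times> (real^'n) \<Rightarrow> real" where
  "dx k f z = frechet_derivative f (at z) (axis k 1, 0)"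

definition dy :: "'n \<Rightarrow> ((real^'n) \<times> (real^'n) \<Rightarrow> real) \<Rightarrow> (real^'n) \<times> (real^'n) \<Rightarrow> real" where
  "dy k f z = frechet_derivative f (at z) (0, axis k 1)"

context
  fixes G :: "(real^'n) \<times> (real^'n) \<Rightarrow> real^'n"
begin

definition riemann :: "'n \<Rightarrow> 'n \<Rightarrow> (real^'n) \<times> (real^'n) \<Rightarrow> real" where
  "riemann i k z =
     2 * dx k (\<lambda>z. G z $ i) z
     - (\<Sum>j\<in>UNIV. snd z $ j * dx j (dy k (\<lambda>z. G z $ i)) z)
     + 2 * (\<Sum>j\<in>UNIV. G z $ j * dy j (dy k (\<lambda>z. G z $ i)) z)
     - (\<Sum>j\<in>UNIV. dy j (\<lambda>z. G z $ i) z * dy k (\<lambda>z. G z $ j) z)"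

definition ricci :: "(real^'n) \<times> (real^'n) \<Rightarrow> real" where
  "ricci z = (\<Sum>i\<in>UNIV. riemann i i z)"

text \<open>\<open>hd_fun j f\<close> is \<open>f\<^bsub>;j\<^esub>\<close> and \<open>hd_cov i j T\<close> is \<open>T\<^bsub>i;j\<^esub>\<close>.\<close>

definition hd_fun :: "'n \<Rightarrow> ((real^'n) \<times> (real^'n) \<Rightarrow> real) \<Rightarrow> (real^'n) \<times> (real^'n) \<Rightarrow> real" where
  "hd_fun j f z = dx j f z - (\<Sum>r\<in>UNIV. dy j (\<lambda>z. G z $ r) z * dy r f z)"

definition hd_cov :: "'n \<Rightarrow> 'n \<Rightarrow> ((real^'n) \<times> (real^'n) \<Rightarrow> real^'n) \<Rightarrow> (real^'n) \<times> (real^'n) \<Rightarrow> real" where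
  "hd_cov i j T z = hd_fun j (\<lambda>z. T z $ i) z
     - (\<Sum>r\<in>UNIV. T z $ r * dy j (dy i (\<lambda>z. G z $ r)) z)"

end

definition weakly_Ricci_constant ::
  "'p set \<Rightarrow> ('p, real^'n) chart set \<Rightarrow> ('p, real^'n) tvec set \<Rightarrow> ('p, real^'n) tm_field \<Rightarrow> bool" where
  "weakly_Ricci_constant M A C X \<longleftrightarrow> (\<forall>c\<in>A. \<forall>z \<in> region_in M A C c.
     (let G = spray_coeff M A X c in (\<Sum>r\<in>UNIV. hd_fun G r (ricci G) z * snd z $ r) = 0))"

text \<open>A covector on \<open>C\<close>, i.e. \<open>\<tau> = \<tau>\<^sub>k(x, y) dx\<^sup>k\<close>, given by its components \<open>\<tau> w c\<close> in the chart \<open>c\<close>;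
  the condition says that the pairing with tangent vectors does not depend on the chart.\<close>

definition covector_on ::
  "('p, 'e::euclidean_space) chart set \<Rightarrow> ('p, 'e) tvec set \<Rightarrow> (('p, 'e) tvec \<Rightarrow> ('p, 'e) comps) \<Rightarrow> bool" where
  "covector_on A C \<tau> \<longleftrightarrow> (\<forall>w\<in>C. \<forall>v \<in> tangent_space A (fst w). \<forall>c\<in>A. \<forall>d\<in>A.
     fst w \<in> fst c \<inter> fst d \<longrightarrow> \<tau> w c \<bullet> v c = \<tau> w d \<bullet> v d)"

definition constant_curvature ::
  "'p set \<Rightarrow> ('p, real^'n) chart set \<Rightarrow> ('p, real^'n) tvec set \<Rightarrow> ('p, real^'n) tm_field \<Rightarrow> bool" where
  "constant_curvature M A C X \<longleftrightarrow> (\<exists>(R :: ('p, real^'n) tvec \<Rightarrow> real) \<tau>. covector_on A C \<tau> \<and>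
     (\<forall>c\<in>A. \<forall>z \<in> region_in M A C c.
       (let G = spray_coeff M A X c; T = (\<lambda>z. fun_in M A \<tau> c z c) in
          (\<forall>i k. riemann G i k z =
             fun_in M A R c z * (if i = k then 1 else 0) - T z $ k * snd z $ i) \<and>
          T differentiable (at z) \<and>
          (\<forall>i k. hd_cov G i k T z = 0))))"

end

theory Submission
  imports Defs
begin

text \<open>In a chart where the locally Minkowski spray has vanishing coefficients, \<open>G\<^sup>i = P y\<^sup>i\<close> with \<open>P\<close>
  positively homogeneous of degree one in \<open>y\<close>. Euler's identities collapse the trace of the Riemann
  curvature to \<open>Ric = (n - 1) \<Xi>\<close> with \<open>\<Xi> = P\<^sup>2 - y\<^sup>k \<partial>\<^sub>k P\<close> (\<open>ricci_eq\<close>). Along a geodesic \<open>x' = y\<close> and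
  \<open>y' = - 2 P y\<close>, and the chain rule gives \<open>P' + P\<^sup>2 = - \<Xi>\<close> (\<open>P_along_geodesic\<close>).

  On the other hand \<open>Ric\<^bsub>;0\<^esub>\<close> is the derivative of \<open>Ric\<close> along geodesics. If it vanishes, then, as
  \<open>n \<ge> 2\<close>, also \<open>\<Xi>\<close> is constant along geodesics, and \<open>P(s)\<close> solves Riccati's equation
  \<open>P' = k - P\<^sup>2\<close> with a constant \<open>k\<close> (\<open>riccati_along_geodesic\<close>). Its solutions for \<open>k = 0\<close>, \<open>k < 0\<close> and
  \<open>k > 0\<close> are the three families of the theorem (\<open>riccati_solutions\<close>), where the zero solution and
  the stationary solutions are members of the exponential family. If the spray is complete, the
  geodesic extends to the whole line, where the first two families have poles unless they vanish
  identically (\<open>riccati_solutions_global\<close>).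

  Constant curvature is a special case of weak Ricci constancy: since \<open>R\<^sup>i\<^sub>k y\<^sup>k = 0\<close> for every spray,
  \<open>R\<^sup>i\<^sub>k = R \<delta>\<^sup>i\<^sub>k - \<tau>\<^sub>k y\<^sup>i\<close> implies \<open>R = \<tau>\<^sub>k y\<^sup>k\<close>, so \<open>Ric = (n - 1) \<tau>\<^sub>k y\<^sup>k\<close>, and this is constant along
  geodesics because \<open>\<tau>\<close> is parallel (\<open>constant_curvature_weakly_Ricci_constant\<close>).\<close>


section \<open>Partial derivatives and homogeneous functions\<close>

lemma frechet_derivative_eqI:
  "(f has_derivative f') (at x) \<Longrightarrow> frechet_derivative f (at x) = f'"
  by (rule frechet_derivative_at[symmetric])

lemma frechet_derivative_mult:
  fixes f g :: "'a::real_normed_vector \<Rightarrow> real"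
  assumes "f differentiable at z" "g differentiable at z"
  shows "frechet_derivative (\<lambda>w. f w * g w) (at z) b =
    f z * frechet_derivative g (at z) b + frechet_derivative f (at z) b * g z"
proof -
  note D = assms[unfolded frechet_derivative_works]
  show ?thesis
    by (simp only: frechet_derivative_eqI[OF has_derivative_mult[OF D]])
qed

lemma frechet_derivative_sum:
  assumes "\<And>i. i \<in> S \<Longrightarrow> f i differentiable at z"
  shows "frechet_derivative (\<lambda>w. \<Sum>i\<in>S. f i w) (at z) b = (\<Sum>i\<in>S. frechet_derivative (f i) (at z) b)"
proof -
  have "((\<lambda>w. \<Sum>i\<in>S. f i w) has_derivative (\<lambda>b. \<Sum>i\<in>S. frechet_derivative (f i) (at z) b)) (at z)"
    using assms by (intro has_derivative_sum) (simp add: frechet_derivative_works[symmetric])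
  from frechet_derivative_eqI[OF this] show ?thesis by simp
qed

text \<open>On \<open>TM\<close> in coordinates, points are pairs \<open>(x, y)\<close>; the fibre coordinates \<open>y\<^sup>i\<close> are the functions
  \<open>\<lambda>w. snd w $ i\<close>.\<close>

lemma has_derivative_fibre_coord: "((\<lambda>w. snd w $ i) has_derivative (\<lambda>b. snd b $ i)) (at z)"
  by (intro bounded_linear_imp_has_derivative bounded_linear_compose[OF bounded_linear_vec_nth]
      bounded_linear_snd)

lemma frechet_derivative_fibre_coord [simp]:
  "frechet_derivative (\<lambda>w. snd w $ i) (at z) b = snd b $ i"
  by (simp add: frechet_derivative_eqI[OF has_derivative_fibre_coord])

lemma differentiable_fibre_coord [simp]: "(\<lambda>w. snd w $ i) differentiable (at z)"
  by (rule differentiableI[OF has_derivative_fibre_coord])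

lemma frechet_derivative_vec_nth:
  fixes f :: "'a::real_normed_vector \<Rightarrow> real^'n"
  assumes "f differentiable at z"
  shows "frechet_derivative (\<lambda>w. f w $ i) (at z) b = frechet_derivative f (at z) b $ i"
    and "(\<lambda>w. f w $ i) differentiable at z"
proof -
  have "((\<lambda>w. f w $ i) has_derivative (\<lambda>b. frechet_derivative f (at z) b $ i)) (at z)"
    using assms by (intro bounded_linear.has_derivative[OF bounded_linear_vec_nth])
      (simp add: frechet_derivative_works)
  then show "frechet_derivative (\<lambda>w. f w $ i) (at z) b = frechet_derivative f (at z) b $ i"
    "(\<lambda>w. f w $ i) differentiable at z"
    by (auto simp: frechet_derivative_eqI differentiable_def)
qed

lemma vec_eq_sum_axis: "(v :: real^'n) = (\<Sum>k\<in>UNIV. v $ k *\<^sub>R axis k 1)"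
  using basis_expansion[of v] by (simp add: scalar_mult_eq_scaleR)

lemma frechet_derivative_split:
  fixes f :: "(real^'n) \<times> (real^'n) \<Rightarrow> real"
  assumes "f differentiable at z"
  shows "frechet_derivative f (at z) (u, v) = (\<Sum>k\<in>UNIV. u $ k * dx k f z) + (\<Sum>k\<in>UNIV. v $ k * dy k f z)"
proof -
  interpret linear "frechet_derivative f (at z)"
    by (rule linear_frechet_derivative[OF assms])
  have "(u, v) = (\<Sum>k\<in>UNIV. u $ k *\<^sub>R (axis k 1, 0)) + (\<Sum>k\<in>UNIV. v $ k *\<^sub>R (0, axis k 1))"
    using vec_eq_sum_axis[of u] vec_eq_sum_axis[of v]
    by (intro prod_eqI) (simp_all add: fst_sum snd_sum)
  then have "frechet_derivative f (at z) (u, v) =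
      (\<Sum>k\<in>UNIV. frechet_derivative f (at z) (u $ k *\<^sub>R (axis k 1, 0))) +
      (\<Sum>k\<in>UNIV. frechet_derivative f (at z) (v $ k *\<^sub>R (0, axis k 1)))"
    by (simp only: add sum)
  then show ?thesis
    by (simp only: scale dx_def dy_def real_scaleR_def)
qed

text \<open>Euler's theorem: compare the derivatives at \<open>t = 1\<close> of the two sides of the homogeneity
  relation.\<close>

lemma euler_homogeneous:
  fixes f :: "'a::real_normed_vector \<times> 'b::real_normed_vector \<Rightarrow> real"
  assumes f: "f differentiable at (x, y)"
    and hom: "\<And>t. t > 0 \<Longrightarrow> f (x, t *\<^sub>R y) = t ^ m * f (x, y)"
  shows "frechet_derivative f (at (x, y)) (0, y) = m * f (x, y)"
proof -
  have "((\<lambda>t::real. (x, t *\<^sub>R y)) has_derivative (\<lambda>h. (0, h *\<^sub>R y))) (at 1)"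
    by (auto intro!: derivative_eq_intros)
  moreover have "(f has_derivative frechet_derivative f (at (x, y))) (at (x, 1 *\<^sub>R y))"
    using f by (simp add: frechet_derivative_works)
  ultimately have "((\<lambda>t::real. f (x, t *\<^sub>R y)) has_derivative
      (\<lambda>h. frechet_derivative f (at (x, y)) (0, h *\<^sub>R y))) (at 1)"
    by (rule has_derivative_compose)
  moreover have "((\<lambda>t. f (x, t *\<^sub>R y)) has_derivative (\<lambda>h. h * (m * f (x, y)))) (at 1)"
  proof (rule has_derivative_transform_within_open[where s = "{0<..}"])
    show "((\<lambda>t. t ^ m * f (x, y)) has_derivative (\<lambda>h. h * (m * f (x, y)))) (at 1)"
      by (auto intro!: derivative_eq_intros)
  qed (auto simp: hom)
  ultimately have "(\<lambda>h. frechet_derivative f (at (x, y)) (0, h *\<^sub>R y)) = (\<lambda>h. h * (m * f (x, y)))"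
    by (rule has_derivative_unique)
  from fun_cong[OF this, of 1] show ?thesis by simp
qed

text \<open>Euler's identity holds on an open set, so it may be differentiated: in a base direction this
  gives the second equation, and in a fibre direction the third, where the derivative of the factor
  \<open>y\<^sup>k\<close> contributes the term that lowers \<open>m\<close> to \<open>m - 1\<close>. All curvature computations below reduce to
  these three identities, for the spray coefficients (\<open>m = 2\<close>) and for the projective factor
  (\<open>m = 1\<close>).\<close>

lemma euler_partials:
  fixes f :: "(real^'n) \<times> (real^'n) \<Rightarrow> real"
  assumes \<Omega>: "open \<Omega>" "\<And>x y t. (x, y) \<in> \<Omega> \<Longrightarrow> t > 0 \<Longrightarrow> f (x, t *\<^sub>R y) = t ^ m * f (x, y)"
    and f: "\<And>z. z \<in> \<Omega> \<Longrightarrow> f differentiable at z"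
    and f2: "\<And>z k. z \<in> \<Omega> \<Longrightarrow> dy k f differentiable at z"
    and z: "z \<in> \<Omega>"
  shows "(\<Sum>k\<in>UNIV. snd z $ k * dy k f z) = m * f z"
    and "(\<Sum>k\<in>UNIV. snd z $ k * dx j (dy k f) z) = m * dx j f z"
    and "(\<Sum>k\<in>UNIV. snd z $ k * dy j (dy k f) z) = (real m - 1) * dy j f z"
proof -
  have euler: "(\<Sum>k\<in>UNIV. snd w $ k * dy k f w) = m * f w" if "w \<in> \<Omega>" for w
    using euler_homogeneous[of f "fst w" "snd w" m] frechet_derivative_split[of f w 0 "snd w"]
      f[OF that] \<Omega>(2)[of "fst w" "snd w"] that by simp
  show "(\<Sum>k\<in>UNIV. snd z $ k * dy k f z) = m * f z"
    by (rule euler[OF z])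
  have "m * frechet_derivative f (at z) b =
      (\<Sum>k\<in>UNIV. snd z $ k * frechet_derivative (dy k f) (at z) b + snd b $ k * dy k f z)" for b
  proof -
    have "frechet_derivative (\<lambda>w. \<Sum>k\<in>UNIV. snd w $ k * dy k f w) (at z) =
        frechet_derivative (\<lambda>w. m * f w) (at z)"
      using f2[OF z] z by (intro frechet_derivative_transform_within_open[OF _ \<Omega>(1)])
        (simp_all add: euler)
    then show ?thesis
      using f2[OF z] f[OF z]
      by (cases b) (simp add: frechet_derivative_sum frechet_derivative_mult fun_eq_iff)
  qed
  note * = this
  show "(\<Sum>k\<in>UNIV. snd z $ k * dx j (dy k f) z) = m * dx j f z"
    using *[of "(axis j 1, 0)"] by (simp add: dx_def)
  show "(\<Sum>k\<in>UNIV. snd z $ k * dy j (dy k f) z) = (real m - 1) * dy j f z"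
    using *[of "(0, axis j 1)"]
    by (simp add: dy_def[of j] sum.distrib axis_def if_distrib[of "\<lambda>x. x * _"] cong: if_cong)
       (simp add: algebra_simps)
qed


section \<open>Sprays in coordinates\<close>

text \<open>The coefficients of a spray in one chart, on the coordinate image \<open>\<Omega>\<close> of the conical region.
  Second differentiability is stated along basis vectors because smoothness is defined through
  iterated derivatives along the basis.\<close>

locale local_spray =
  fixes \<Omega> :: "((real^'n) \<times> (real^'n)) set" and G :: "(real^'n) \<times> (real^'n) \<Rightarrow> real^'n"
  assumes open_region: "open \<Omega>"
    and nonzero: "z \<in> \<Omega> \<Longrightarrow> snd z \<noteq> 0"
    and conical: "(x, y) \<in> \<Omega> \<Longrightarrow> t > 0 \<Longrightarrow> (x, t *\<^sub>R y) \<in> \<Omega>"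
    and homogeneous: "(x, y) \<in> \<Omega> \<Longrightarrow> t > 0 \<Longrightarrow> G (x, t *\<^sub>R y) = t\<^sup>2 *\<^sub>R G (x, y)"
    and differentiable: "z \<in> \<Omega> \<Longrightarrow> G differentiable (at z)"
    and differentiable2: "z \<in> \<Omega> \<Longrightarrow> b \<in> Basis \<Longrightarrow>
      (\<lambda>w. frechet_derivative G (at w) b) differentiable (at z)"
begin

lemma differentiable_cong:
  assumes "z \<in> \<Omega>" "f differentiable at z" "\<And>w. w \<in> \<Omega> \<Longrightarrow> f w = g w"
  shows "g differentiable at z"
  using assms has_derivative_transform_within_open[OF _ open_region] unfolding differentiable_def
  by metis

lemma frechet_derivative_cong:
  assumes "z \<in> \<Omega>" "f differentiable at z" "\<And>w. w \<in> \<Omega> \<Longrightarrow> f w = g w"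
  shows "frechet_derivative f (at z) = frechet_derivative g (at z)"
  using assms by (intro frechet_derivative_transform_within_open[OF _ open_region])

lemma comp_differentiable: "z \<in> \<Omega> \<Longrightarrow> (\<lambda>w. G w $ i) differentiable at z"
  using differentiable frechet_derivative_vec_nth(2) by blast

lemma dy_differentiable:
  assumes "z \<in> \<Omega>"
  shows "dy k (\<lambda>w. G w $ i) differentiable at z"
proof (rule differentiable_cong[OF assms])
  show "(\<lambda>w. frechet_derivative G (at w) (0, axis k 1) $ i) differentiable at z"
    using assms by (intro frechet_derivative_vec_nth(2) differentiable2) (auto simp: Basis_prod_def)
qed (simp add: dy_def frechet_derivative_vec_nth differentiable)

lemma euler_G:
  assumes "z \<in> \<Omega>"
  shows "(\<Sum>k\<in>UNIV. snd z $ k * dy k (\<lambda>w. G w $ i) z) = 2 * G z $ i"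
    and "(\<Sum>k\<in>UNIV. snd z $ k * dx j (dy k (\<lambda>w. G w $ i)) z) = 2 * dx j (\<lambda>w. G w $ i) z"
    and "(\<Sum>k\<in>UNIV. snd z $ k * dy j (dy k (\<lambda>w. G w $ i)) z) = dy j (\<lambda>w. G w $ i) z"
proof -
  have hom: "G (x, t *\<^sub>R y) $ i = t\<^sup>2 * G (x, y) $ i" if "(x, y) \<in> \<Omega>" "t > 0" for x y t
    using homogeneous[OF that] by simp
  note euler = euler_partials[of \<Omega> "\<lambda>w. G w $ i" 2,
      OF open_region hom comp_differentiable dy_differentiable assms]
  show "(\<Sum>k\<in>UNIV. snd z $ k * dy k (\<lambda>w. G w $ i) z) = 2 * G z $ i"
    using euler(1) by simp
  show "(\<Sum>k\<in>UNIV. snd z $ k * dx j (dy k (\<lambda>w. G w $ i)) z) = 2 * dx j (\<lambda>w. G w $ i) z"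
    using euler(2)[of j] by simp
  show "(\<Sum>k\<in>UNIV. snd z $ k * dy j (dy k (\<lambda>w. G w $ i)) z) = dy j (\<lambda>w. G w $ i) z"
    using euler(3)[of j] by simp
qed

text \<open>\<open>f\<^bsub>;0\<^esub>\<close> is the derivative of \<open>f\<close> along the spray, because \<open>G\<^sup>r\<^sub>j y\<^sup>j = 2 G\<^sup>r\<close> by Euler. So
  \<open>Ric\<^bsub>;0\<^esub> = 0\<close> says that the Ricci curvature is constant along geodesics.\<close>

lemma hd_fun_along_spray:
  assumes z: "z \<in> \<Omega>" and f: "f differentiable at z"
  shows "(\<Sum>r\<in>UNIV. hd_fun G r f z * snd z $ r) = frechet_derivative f (at z) (snd z, - 2 *\<^sub>R G z)"
proof -
  have "(\<Sum>r\<in>UNIV. hd_fun G r f z * snd z $ r) = (\<Sum>r\<in>UNIV. snd z $ r * dx r f z)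
      - (\<Sum>r\<in>UNIV. \<Sum>q\<in>UNIV. snd z $ r * dy r (\<lambda>w. G w $ q) z * dy q f z)"
    by (simp add: hd_fun_def right_diff_distrib sum_subtractf sum_distrib_left
        mult.commute[of _ "snd z $ _"] mult.assoc)
  also have "(\<Sum>r\<in>UNIV. \<Sum>q\<in>UNIV. snd z $ r * dy r (\<lambda>w. G w $ q) z * dy q f z) =
      (\<Sum>q\<in>UNIV. (\<Sum>r\<in>UNIV. snd z $ r * dy r (\<lambda>w. G w $ q) z) * dy q f z)"
    by (subst sum.swap) (simp add: sum_distrib_right)
  finally show ?thesis
    by (simp add: euler_G(1)[OF z] frechet_derivative_split[OF f] sum_negf)
qed

text \<open>After contraction with \<open>y\<^sup>k\<close>, Euler's identities cancel the first term of \<open>R\<^sup>i\<^sub>k\<close> against the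
  second and the third against the fourth.\<close>

lemma riemann_contraction:
  assumes z: "z \<in> \<Omega>"
  shows "(\<Sum>k\<in>UNIV. riemann G i k z * snd z $ k) = 0"
proof -
  let ?y = "\<lambda>k. snd z $ k" and ?g = "\<lambda>w. G w $ i"
  have swap: "(\<Sum>k\<in>UNIV. \<Sum>j\<in>UNIV. a j * b j k) = (\<Sum>j\<in>UNIV. \<Sum>k\<in>UNIV. a j * b j k)"
    for a :: "'n \<Rightarrow> real" and b
    by (rule sum.swap)
  have "(\<Sum>k\<in>UNIV. riemann G i k z * ?y k) =
      2 * (\<Sum>k\<in>UNIV. ?y k * dx k ?g z)
      - (\<Sum>k\<in>UNIV. \<Sum>j\<in>UNIV. ?y j * (?y k * dx j (dy k ?g) z))
      + 2 * (\<Sum>k\<in>UNIV. \<Sum>j\<in>UNIV. G z $ j * (?y k * dy j (dy k ?g) z))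
      - (\<Sum>k\<in>UNIV. \<Sum>j\<in>UNIV. dy j ?g z * (?y k * dy k (\<lambda>w. G w $ j) z))"
    by (simp add: riemann_def sum_subtractf sum.distrib sum_distrib_left algebra_simps)
  also have "\<dots> = 2 * (\<Sum>k\<in>UNIV. ?y k * dx k ?g z)
      - (\<Sum>j\<in>UNIV. ?y j * (2 * dx j ?g z))
      + 2 * (\<Sum>j\<in>UNIV. G z $ j * dy j ?g z)
      - (\<Sum>j\<in>UNIV. dy j ?g z * (2 * G z $ j))"
    unfolding swap by (simp only: sum_distrib_left[symmetric] euler_G[OF z])
  also have "\<dots> = 0"
    by (simp add: sum_distrib_left algebra_simps)
  finally show ?thesis .
qed

text \<open>Contracting \<open>R\<^sup>i\<^sub>k = R \<delta>\<^sup>i\<^sub>k - \<tau>\<^sub>k y\<^sup>i\<close> with \<open>y\<^sup>k\<close> gives \<open>0\<close> on the left, whence \<open>R = \<tau>\<^sub>k y\<^sup>k\<close> as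
  \<open>y \<noteq> 0\<close>; the trace is then \<open>n R - R\<close>.\<close>

lemma ricci_constant_curvature:
  assumes z: "z \<in> \<Omega>"
    and R: "\<And>i k. riemann G i k z = R * (if i = k then 1 else 0) - T $ k * snd z $ i"
  shows "ricci G z = (real CARD('n) - 1) * (T \<bullet> snd z)"
proof -
  obtain i where i: "snd z $ i \<noteq> 0"
    using nonzero[OF z] by (metis vec_eq_iff zero_index)
  have "0 = (\<Sum>k\<in>UNIV. (R * (if i = k then 1 else 0) - T $ k * snd z $ i) * snd z $ k)"
    using riemann_contraction[OF z, of i] by (simp add: R)
  also have "\<dots> = (\<Sum>k\<in>UNIV. if i = k then R * snd z $ i else 0) - (\<Sum>k\<in>UNIV. T $ k * snd z $ k * snd z $ i)"
    unfolding sum_subtractf[symmetric] by (rule sum.cong) (auto simp: algebra_simps)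
  also have "\<dots> = (R - T \<bullet> snd z) * snd z $ i"
    by (simp add: inner_vec_def sum_distrib_right left_diff_distrib)
  finally have "R = T \<bullet> snd z"
    using i by simp
  then show ?thesis
    by (simp add: ricci_def R sum_subtractf inner_vec_def left_diff_distrib)
qed

text \<open>The Ricci curvature is \<open>n - 1\<close> times \<open>\<tau>\<^sub>i y\<^sup>i\<close>. The derivative of \<open>\<tau>\<^sub>i y\<^sup>i\<close> along the spray is
  \<open>\<tau>\<^bsub>i;k\<^esub> y\<^sup>i y\<^sup>k\<close>: the connection term \<open>\<tau>\<^sub>r G\<^sup>r\<^bsub>ik\<^esub> y\<^sup>i y\<^sup>k = 2 \<tau>\<^sub>r G\<^sup>r\<close> in the latter is exactly what the
  spray produces when it differentiates the factor \<open>y\<^sup>i\<close>.\<close>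

lemma constant_curvature_imp_weakly_Ricci_constant:
  assumes R: "\<And>w i k. w \<in> \<Omega> \<Longrightarrow> riemann G i k w = R w * (if i = k then 1 else 0) - T w $ k * snd w $ i"
    and z: "z \<in> \<Omega>" and T: "T differentiable (at z)"
    and parallel: "\<And>i k. hd_cov G i k T z = 0"
  shows "(\<Sum>r\<in>UNIV. hd_fun G r (ricci G) z * snd z $ r) = 0"
proof -
  let ?n = "real CARD('n) - 1"
  let ?v = "(snd z, - 2 *\<^sub>R G z)"
  define f where "f = (\<lambda>w. ?n * (\<Sum>i\<in>UNIV. T w $ i * snd w $ i))"
  have f: "f differentiable at z"
    unfolding f_def by (simp add: frechet_derivative_vec_nth(2)[OF T])
  have "f w = ricci G w" if "w \<in> \<Omega>" for w
    using ricci_constant_curvature[OF that R[OF that]] by (simp add: f_def inner_vec_def)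
  note ric = differentiable_cong[OF z f this] frechet_derivative_cong[OF z f this]
  have "0 = (\<Sum>k\<in>UNIV. \<Sum>i\<in>UNIV. hd_cov G i k T z * snd z $ k * snd z $ i)"
    by (simp add: parallel)
  also have "\<dots> = (\<Sum>k\<in>UNIV. \<Sum>i\<in>UNIV. hd_fun G k (\<lambda>w. T w $ i) z * snd z $ k * snd z $ i)
      - (\<Sum>k\<in>UNIV. \<Sum>i\<in>UNIV. \<Sum>r\<in>UNIV. T z $ r * snd z $ k * (snd z $ i * dy k (dy i (\<lambda>w. G w $ r)) z))"
    by (simp add: hd_cov_def sum_subtractf sum_distrib_right sum_distrib_left algebra_simps)
  also have "(\<Sum>k\<in>UNIV. \<Sum>i\<in>UNIV. hd_fun G k (\<lambda>w. T w $ i) z * snd z $ k * snd z $ i)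
      = (\<Sum>i\<in>UNIV. frechet_derivative (\<lambda>w. T w $ i) (at z) ?v * snd z $ i)"
    by (subst sum.swap)
      (simp only: sum_distrib_right[symmetric] hd_fun_along_spray[OF z frechet_derivative_vec_nth(2)[OF T]])
  also have "(\<Sum>k\<in>UNIV. \<Sum>i\<in>UNIV. \<Sum>r\<in>UNIV. T z $ r * snd z $ k * (snd z $ i * dy k (dy i (\<lambda>w. G w $ r)) z))
      = (\<Sum>k\<in>UNIV. \<Sum>r\<in>UNIV. T z $ r * (snd z $ k * dy k (\<lambda>w. G w $ r) z))"
    by (subst sum.swap) (simp only: sum_distrib_left[symmetric] euler_G(3)[OF z] mult.assoc)
  also have "\<dots> = (\<Sum>r\<in>UNIV. T z $ r * (2 * G z $ r))"
    by (subst sum.swap) (simp only: sum_distrib_left[symmetric] euler_G(1)[OF z])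
  finally have "(\<Sum>i\<in>UNIV. frechet_derivative (\<lambda>w. T w $ i) (at z) ?v * snd z $ i) 
      - (\<Sum>r\<in>UNIV. T z $ r * (2 * G z $ r)) = 0" by simp
  then have "frechet_derivative f (at z) ?v = 0"
    unfolding f_def
    by (simp add: frechet_derivative_mult frechet_derivative_sum frechet_derivative_vec_nth(2)[OF T]
        sum.distrib sum_negf sum_subtractf)
  then show ?thesis
    using hd_fun_along_spray[OF z ric(1)] ric(2) by simp
qed

end

section \<open>Projectively flat sprays in coordinates\<close>

text \<open>A chart in which the locally Minkowski spray has vanishing coefficients.\<close>

locale projectively_flat_spray = local_spray \<Omega> G
  for \<Omega> :: "((real^'n) \<times> (real^'n)) set" and G +
  fixes P :: "(real^'n) \<times> (real^'n) \<Rightarrow> real"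
  assumes G_eq: "z \<in> \<Omega> \<Longrightarrow> G z = P z *\<^sub>R snd z"
begin

text \<open>The projective factor is a function about which only \<open>G\<^sup>i = P y\<^sup>i\<close> is known. Recovering it as a
  quotient of functions of \<open>G\<close> transfers the regularity of \<open>G\<close> to \<open>P\<close>.\<close>

lemma P_eq: "z \<in> \<Omega> \<Longrightarrow> (G z \<bullet> snd z) / (snd z \<bullet> snd z) = P z"
  using nonzero by (simp add: G_eq)

lemma P_homogeneous:
  assumes "(x, y) \<in> \<Omega>" "t > 0"
  shows "P (x, t *\<^sub>R y) = t * P (x, y)"
  using assms nonzero[OF assms(1)] G_eq[OF assms(1)] G_eq[OF conical[OF assms]] homogeneous[OF assms]
  by (simp add: power2_eq_square)

lemma P_has_derivative:
  assumes z: "z \<in> \<Omega>"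
  shows "(P has_derivative (\<lambda>b. ((frechet_derivative G (at z) b \<bullet> snd z + G z \<bullet> snd b) * (snd z \<bullet> snd z)
    - (G z \<bullet> snd z) * (2 * (snd z \<bullet> snd b))) / (snd z \<bullet> snd z)\<^sup>2)) (at z)"
proof (rule has_derivative_transform_within_open[OF _ open_region z P_eq])
  have G: "(G has_derivative frechet_derivative G (at z)) (at z)"
    using differentiable[OF z] by (simp add: frechet_derivative_works)
  show "((\<lambda>z. (G z \<bullet> snd z) / (snd z \<bullet> snd z)) has_derivative (\<lambda>b. ((frechet_derivative G (at z) b \<bullet> snd z + G z \<bullet> snd b) * (snd z \<bullet> snd z)
    - (G z \<bullet> snd z) * (2 * (snd z \<bullet> snd b))) / (snd z \<bullet> snd z)\<^sup>2)) (at z)"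
    using nonzero[OF z]
    by (auto intro!: derivative_eq_intros G simp: inner_commute power2_eq_square algebra_simps)
qed

lemma P_differentiable: "z \<in> \<Omega> \<Longrightarrow> P differentiable at z"
  using P_has_derivative differentiableI by blast

lemma P_differentiable2:
  assumes z: "z \<in> \<Omega>" and b: "b \<in> Basis"
  shows "(\<lambda>w. frechet_derivative P (at w) b) differentiable (at z)"
proof (rule differentiable_cong[OF z])
  have snd: "snd differentiable at z"
    by (simp add: bounded_linear_imp_differentiable bounded_linear_snd)
  show "(\<lambda>w. ((frechet_derivative G (at w) b \<bullet> snd w + G w \<bullet> snd b) * (snd w \<bullet> snd w)
    - (G w \<bullet> snd w) * (2 * (snd w \<bullet> snd b))) / (snd w \<bullet> snd w)\<^sup>2) differentiable (at z)"
    using nonzero[OF z] snd differentiable[OF z] differentiable2[OF z b]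
    by (intro differentiable_divide differentiable_diff differentiable_mult differentiable_add
        differentiable_inner differentiable_power differentiable_const) auto
qed (simp add: frechet_derivative_eqI[OF P_has_derivative])

lemma dx_P_differentiable: "z \<in> \<Omega> \<Longrightarrow> dx k P differentiable at z"
  unfolding dx_def[abs_def] by (rule P_differentiable2) (auto simp: Basis_prod_def)

lemma dy_P_differentiable: "z \<in> \<Omega> \<Longrightarrow> dy k P differentiable at z"
  unfolding dy_def[abs_def] by (rule P_differentiable2) (auto simp: Basis_prod_def)

lemma euler_P:
  assumes "z \<in> \<Omega>"
  shows "(\<Sum>k\<in>UNIV. snd z $ k * dy k P z) = P z"
    and "(\<Sum>k\<in>UNIV. snd z $ k * dx j (dy k P) z) = dx j P z"
    and "(\<Sum>k\<in>UNIV. snd z $ k * dy j (dy k P) z) = 0"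
proof -
  have hom: "P (x, t *\<^sub>R y) = t ^ 1 * P (x, y)" if "(x, y) \<in> \<Omega>" "t > 0" for x y t
    using P_homogeneous[OF that] by simp
  note euler = euler_partials[of \<Omega> P 1, OF open_region hom P_differentiable dy_P_differentiable assms]
  show "(\<Sum>k\<in>UNIV. snd z $ k * dy k P z) = P z"
    using euler(1) by simp
  show "(\<Sum>k\<in>UNIV. snd z $ k * dx j (dy k P) z) = dx j P z"
    using euler(2)[of j] by simp
  show "(\<Sum>k\<in>UNIV. snd z $ k * dy j (dy k P) z) = 0"
    using euler(3)[of j] by simp
qed

lemma frechet_derivative_G:
  assumes "z \<in> \<Omega>"
  shows "frechet_derivative (\<lambda>w. G w $ i) (at z) b =
    P z * snd b $ i + frechet_derivative P (at z) b * snd z $ i"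
proof -
  have "frechet_derivative (\<lambda>w. P w * snd w $ i) (at z) = frechet_derivative (\<lambda>w. G w $ i) (at z)"
    using assms by (intro frechet_derivative_cong) (simp_all add: P_differentiable G_eq)
  then show ?thesis
    using frechet_derivative_mult[OF P_differentiable[OF assms] differentiable_fibre_coord, of i b]
    by simp
qed

lemma dx_G: "z \<in> \<Omega> \<Longrightarrow> dx k (\<lambda>w. G w $ i) z = dx k P z * snd z $ i"
  by (simp add: dx_def frechet_derivative_G)

lemma dy_G: "z \<in> \<Omega> \<Longrightarrow> dy k (\<lambda>w. G w $ i) z = dy k P z * snd z $ i + P z * (if i = k then 1 else 0)"
  by (simp add: dy_def frechet_derivative_G axis_def)

lemma frechet_derivative_dy_G:
  assumes "z \<in> \<Omega>"
  shows "frechet_derivative (dy k (\<lambda>w. G w $ i)) (at z) b =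
    frechet_derivative (dy k P) (at z) b * snd z $ i + dy k P z * snd b $ i
    + frechet_derivative P (at z) b * (if i = k then 1 else 0)"
proof -
  have D: "((\<lambda>w. dy k P w * snd w $ i + P w * (if i = k then 1 else 0)) has_derivative
      (\<lambda>b. (dy k P z * snd b $ i + frechet_derivative (dy k P) (at z) b * snd z $ i)
        + frechet_derivative P (at z) b * (if i = k then 1 else 0))) (at z)"
    using dy_P_differentiable[OF assms] P_differentiable[OF assms]
    by (intro has_derivative_add has_derivative_mult has_derivative_mult_left
        has_derivative_fibre_coord) (simp_all add: frechet_derivative_works)
  have "frechet_derivative (\<lambda>w. dy k P w * snd w $ i + P w * (if i = k then 1 else 0)) (at z)
      = frechet_derivative (dy k (\<lambda>w. G w $ i)) (at z)"
    using D by (intro frechet_derivative_cong[OF assms] differentiableI[OF D]) (simp add: dy_G)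
  then show ?thesis
    using fun_cong[of _ "frechet_derivative (dy k (\<lambda>w. G w $ i)) (at z)" b]
    unfolding frechet_derivative_eqI[OF D] by fastforce
qed

text \<open>The usual notation in projective spray geometry, where \<open>R\<^sup>i\<^sub>k = \<Xi> \<delta>\<^sup>i\<^sub>k + \<tau>\<^sub>k y\<^sup>i\<close> for
  \<open>G\<^sup>i = P y\<^sup>i\<close>.\<close>

definition \<Xi> :: "(real^'n) \<times> (real^'n) \<Rightarrow> real" where
  "\<Xi> z = (P z)\<^sup>2 - (\<Sum>k\<in>UNIV. snd z $ k * dx k P z)"

text \<open>Each of the four sums in the trace of the Riemann curvature collapses by Euler's identities:
  with \<open>P\<^sub>0 = y\<^sup>k \<partial>\<^sub>k P\<close> they contribute \<open>2 P\<^sub>0\<close>, \<open>- (n + 1) P\<^sub>0\<close>, \<open>2 (n + 1) P\<^sup>2\<close> and \<open>- (n + 3) P\<^sup>2\<close>.\<close>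

lemma ricci_eq:
  assumes z: "z \<in> \<Omega>"
  shows "ricci G z = (real CARD('n) - 1) * \<Xi> z"
proof -
  let ?y = "\<lambda>k. snd z $ k" and ?n = "real CARD('n)" and ?P0 = "\<Sum>k\<in>UNIV. snd z $ k * dx k P z"
  have dxdy: "dx j (dy k (\<lambda>w. G w $ i)) z =
      dx j (dy k P) z * ?y i + dx j P z * (if i = k then 1 else 0)" for i j k
    unfolding dx_def by (simp add: frechet_derivative_dy_G[OF z])
  have dydy: "dy j (dy k (\<lambda>w. G w $ i)) z =
      dy j (dy k P) z * ?y i + dy k P z * (if i = j then 1 else 0) + dy j P z * (if i = k then 1 else 0)" for i j k
    unfolding dy_def[of j] by (simp add: frechet_derivative_dy_G[OF z] axis_def)
  have 1: "(\<Sum>i\<in>UNIV. dx i (\<lambda>w. G w $ i) z) = ?P0"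
    by (simp add: dx_G[OF z] mult.commute)
  have "(\<Sum>i\<in>UNIV. \<Sum>j\<in>UNIV. ?y j * dx j (dy i (\<lambda>w. G w $ i)) z) =
      (\<Sum>j\<in>UNIV. ?y j * ((\<Sum>i\<in>UNIV. ?y i * dx j (dy i P) z) + ?n * dx j P z))"
    by (subst sum.swap) (simp add: dxdy sum.distrib distrib_left sum_distrib_left algebra_simps)
  also have "\<dots> = (1 + ?n) * ?P0"
    by (simp add: euler_P(2)[OF z] sum_distrib_left algebra_simps sum.distrib)
  finally have 2: "(\<Sum>i\<in>UNIV. \<Sum>j\<in>UNIV. ?y j * dx j (dy i (\<lambda>w. G w $ i)) z) = (1 + ?n) * ?P0" .
  have trace: "(\<Sum>i\<in>UNIV. dy j (dy i (\<lambda>w. G w $ i)) z) = (1 + ?n) * dy j P z" for j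
    using euler_P(3)[OF z, of j]
    by (simp add: dydy sum.distrib if_distrib[of "\<lambda>x. _ * x"] algebra_simps cong: if_cong)
  have "(\<Sum>i\<in>UNIV. \<Sum>j\<in>UNIV. G z $ j * dy j (dy i (\<lambda>w. G w $ i)) z) =
      (\<Sum>j\<in>UNIV. G z $ j * (\<Sum>i\<in>UNIV. dy j (dy i (\<lambda>w. G w $ i)) z))"
    by (subst sum.swap) (simp only: sum_distrib_left)
  also have "\<dots> = P z * ((1 + ?n) * (\<Sum>j\<in>UNIV. ?y j * dy j P z))"
    by (simp only: trace) (simp add: G_eq[OF z] sum_distrib_left algebra_simps)
  finally have 3: "(\<Sum>i\<in>UNIV. \<Sum>j\<in>UNIV. G z $ j * dy j (dy i (\<lambda>w. G w $ i)) z) = (1 + ?n) * (P z)\<^sup>2"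
    by (simp add: euler_P(1)[OF z] power2_eq_square)
  have "(\<Sum>i\<in>UNIV. \<Sum>j\<in>UNIV. dy j (\<lambda>w. G w $ i) z * dy i (\<lambda>w. G w $ j) z) =
     (\<Sum>i\<in>UNIV. \<Sum>j\<in>UNIV. (?y i * dy i P z) * (?y j * dy j P z)
       + (if i = j then P z * (?y i * dy i P z) * 2 + (P z)\<^sup>2 else 0))"
    by (intro sum.cong refl) (auto simp: dy_G[OF z] power2_eq_square algebra_simps)
  also have "\<dots> = (\<Sum>i\<in>UNIV. ?y i * dy i P z) * (\<Sum>j\<in>UNIV. ?y j * dy j P z)
       + P z * (\<Sum>i\<in>UNIV. ?y i * dy i P z) * 2 + ?n * (P z)\<^sup>2"
    by (simp add: sum.distrib sum_distrib_left[symmetric] sum_distrib_right[symmetric])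
  finally have 4: "(\<Sum>i\<in>UNIV. \<Sum>j\<in>UNIV. dy j (\<lambda>w. G w $ i) z * dy i (\<lambda>w. G w $ j) z) = (3 + ?n) * (P z)\<^sup>2"
    unfolding euler_P(1)[OF z] by (simp add: power2_eq_square algebra_simps)
  show ?thesis
    unfolding ricci_def riemann_def \<Xi>_def
    by (simp only: sum.distrib sum_subtractf sum_distrib_left[symmetric] 1 2 3 4)
       (simp add: algebra_simps)
qed

lemma \<Xi>_differentiable:
  assumes z: "z \<in> \<Omega>" shows "\<Xi> differentiable at z"
  unfolding \<Xi>_def[abs_def] using P_differentiable[OF z] dx_P_differentiable[OF z]
  by (intro differentiable_diff differentiable_power differentiable_sum differentiable_mult) auto

text \<open>Along a geodesic \<open>y' = - 2 P y\<close>, so \<open>P' = P\<^sub>0 - 2 P y\<^sup>k \<partial>P/\<partial>y\<^sup>k = P\<^sub>0 - 2 P\<^sup>2\<close>, again by Euler.\<close>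

lemma P_along_geodesic:
  assumes z: "z s \<in> \<Omega>" and z': "(z has_vector_derivative (snd (z s), - 2 *\<^sub>R G (z s))) (at s)"
  shows "((\<lambda>s. P (z s)) has_real_derivative - \<Xi> (z s) - (P (z s))\<^sup>2) (at s)"
proof -
  have D: "(P has_derivative frechet_derivative P (at (z s))) (at (z s))"
    using P_differentiable[OF z] by (simp add: frechet_derivative_works)
  have "((\<lambda>s. P (z s)) has_vector_derivative frechet_derivative P (at (z s)) (snd (z s), - 2 *\<^sub>R G (z s))) (at s)"
    using vector_derivative_diff_chain_within[of z _ s UNIV P] z' D
    by (auto simp: o_def intro: has_derivative_at_withinI)
  moreover have "frechet_derivative P (at (z s)) (snd (z s), - 2 *\<^sub>R G (z s)) = 
     (\<Sum>k\<in>UNIV. snd (z s) $ k * dx k P (z s)) - 2 * P (z s) * (\<Sum>k\<in>UNIV. snd (z s) $ k * dy k P (z s))"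
    unfolding frechet_derivative_split[OF P_differentiable[OF z]]
    by (simp add: G_eq[OF z] sum_distrib_left sum_negf algebra_simps)
  ultimately show ?thesis
    by (simp add: has_real_derivative_iff_has_vector_derivative \<Xi>_def euler_P(1)[OF z]
        power2_eq_square mult.assoc)
qed

lemma \<Xi>_along_geodesic:
  assumes z: "z s \<in> \<Omega>" and z': "(z has_vector_derivative (snd (z s), - 2 *\<^sub>R G (z s))) (at s)"
    and n: "CARD('n) \<ge> 2"
    and ric: "(\<Sum>r\<in>UNIV. hd_fun G r (ricci G) (z s) * snd (z s) $ r) = 0"
  shows "((\<lambda>s. \<Xi> (z s)) has_real_derivative 0) (at s)"
proof -
  let ?v = "(snd (z s), - 2 *\<^sub>R G (z s))" and ?n = "real CARD('n) - 1"
  note \<Xi> = \<Xi>_differentiable[OF z]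
  have 1: "(\<lambda>w. ?n * \<Xi> w) differentiable at (z s)"
    using \<Xi> by simp
  have "ricci G differentiable at (z s)"
    by (rule differentiable_cong[OF z 1]) (simp add: ricci_eq)
  from hd_fun_along_spray[OF z this] ric
  have "0 = frechet_derivative (ricci G) (at (z s)) ?v"
    by simp
  also have "\<dots> = frechet_derivative (\<lambda>w. ?n * \<Xi> w) (at (z s)) ?v"
    by (subst frechet_derivative_cong[OF z 1, of "ricci G"]) (simp_all add: ricci_eq)
  also have "\<dots> = ?n * frechet_derivative \<Xi> (at (z s)) ?v"
    using \<Xi> by (simp add: frechet_derivative_mult)
  finally have 0: "frechet_derivative \<Xi> (at (z s)) ?v = 0"
    using n by auto
  have "((\<lambda>s. \<Xi> (z s)) has_vector_derivative frechet_derivative \<Xi> (at (z s)) ?v) (at s)"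
    using vector_derivative_diff_chain_within[of z _ s UNIV \<Xi>] z' \<Xi>
    by (auto simp: o_def frechet_derivative_works intro: has_derivative_at_withinI)
  then show ?thesis
    by (simp only: 0 has_real_derivative_iff_has_vector_derivative)
qed

end


section \<open>Riccati's equation\<close>

text \<open>\<open>p - c\<close> solves the linear equation \<open>u' = - (p + c) u\<close>, so multiplying it by \<open>exp F\<close>, with \<open>F\<close> an
  antiderivative of \<open>p + c\<close>, makes it constant. The antiderivative is taken on the compact interval
  between the two points.\<close>

lemma riccati_stationary:
  fixes p :: "real \<Rightarrow> real"
  assumes I: "open I" "is_interval I" and "s0 \<in> I" "p s0 = c"
    and p: "\<And>s. s \<in> I \<Longrightarrow> (p has_real_derivative c\<^sup>2 - (p s)\<^sup>2) (at s)"
    and "s \<in> I"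
  shows "p s = c"
proof -
  define a b where "a = min s0 s" and "b = max s0 s"
  have "a \<in> I" "b \<in> I"
    using assms(3,6) by (simp_all add: a_def b_def min_def max_def)
  then have ab: "{a..b} \<subseteq> I"
    using mem_is_interval_1_I[OF I(2)] atLeastAtMost_iff by blast
  have s: "s0 \<in> {a..b}" "s \<in> {a..b}"
    by (simp_all add: a_def b_def)
  have "continuous_on I p"
    by (rule DERIV_continuous_on) (rule has_field_derivative_at_within[OF p])
  then have "continuous_on {a..b} (\<lambda>t. p t + c)"
    using ab by (auto intro!: continuous_intros elim: continuous_on_subset)
  then obtain F where F: "\<And>t. t \<in> {a..b} \<Longrightarrow>
      (F has_vector_derivative p t + c) (at t within {a..b})"
    using antiderivative_continuous[of a b "\<lambda>t. p t + c"] by metis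
  have "((\<lambda>t. (p t - c) * exp (F t)) has_derivative (\<lambda>h. 0)) (at t within {a..b})"
    if t: "t \<in> {a..b}" for t
  proof -
    have 1: "(F has_real_derivative p t + c) (at t within {a..b})"
      using F[OF t] by (simp add: has_real_derivative_iff_has_vector_derivative)
    have 2: "(p has_real_derivative c\<^sup>2 - (p t)\<^sup>2) (at t within {a..b})"
      using has_field_derivative_at_within[OF p] t ab by blast
    have "((\<lambda>t. (p t - c) * exp (F t)) has_real_derivative 0) (at t within {a..b})"
      by (auto intro!: derivative_eq_intros 1 2 simp: algebra_simps power2_eq_square)
    then show ?thesis
      by (simp add: has_field_derivative_def lambda_zero)
  qed
  then have "\<exists>k. \<forall>t\<in>{a..b}. (p t - c) * exp (F t) = k"
    using has_derivative_zero_constant[of "{a..b}" "\<lambda>t. (p t - c) * exp (F t)"] by auto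
  then have "(p s - c) * exp (F s) = (p s0 - c) * exp (F s0)"
    using s by fastforce
  then show ?thesis
    using assms(4) by simp
qed

lemma zero_derivative_const:
  fixes f :: "real \<Rightarrow> real"
  assumes "is_interval I" "\<And>s. s \<in> I \<Longrightarrow> (f has_real_derivative 0) (at s)"
  shows "\<exists>k. \<forall>s\<in>I. f s = k"
  using assms has_derivative_zero_constant[of I f]
  by (auto simp: is_interval_convex has_field_derivative_def lambda_zero
      intro: has_derivative_at_withinI)

text \<open>The equation is separable, and in each case some function of \<open>p\<close> is affine or exponential in
  \<open>s\<close>: \<open>arctan (p / c)\<close> if \<open>k = - c\<^sup>2 < 0\<close>, \<open>1 / p\<close> if \<open>k = 0\<close>, and \<open>(p + c) / (p - c)\<close> if
  \<open>k = c\<^sup>2 > 0\<close>. The last two require \<open>p \<noteq> c\<close>, with \<open>c = 0\<close> for \<open>k = 0\<close>; by uniqueness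
  \<open>p\<close> takes the value \<open>c\<close> either nowhere or everywhere.\<close>

lemma riccati_solutions:
  fixes p :: "real \<Rightarrow> real"
  assumes I: "open I" "is_interval I"
    and p: "\<And>s. s \<in> I \<Longrightarrow> (p has_real_derivative k - (p s)\<^sup>2) (at s)"
  shows "(\<exists>\<kappa>. \<forall>s\<in>I. s + \<kappa> \<noteq> 0 \<and> p s = 1 / (s + \<kappa>)) \<or>
    (\<exists>c \<kappa>. \<forall>s\<in>I. cos (c * s + \<kappa>) \<noteq> 0 \<and> p s = - c * tan (c * s + \<kappa>)) \<or>
    (\<exists>c \<kappa>. \<forall>s\<in>I. 1 + \<kappa> * exp (2 * c * s) \<noteq> 0 \<and>
       p s = - (c * (1 - \<kappa> * exp (2 * c * s)) / (1 + \<kappa> * exp (2 * c * s))))"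
    (is "?rational \<or> ?tan \<or> ?exp")
proof (cases "k < 0")
  case True
  define c where "c = sqrt (- k)"
  have c: "c > 0" "k = - c\<^sup>2"
    using True by (auto simp: c_def)
  have "((\<lambda>s. arctan (p s / c) + c * s) has_real_derivative 0) (at s)" if "s \<in> I" for s
  proof -
    have pos: "1 + (p s / c)\<^sup>2 \<noteq> 0"
      using zero_le_power2[of "p s / c"] by linarith
    have deriv: "((\<lambda>s. arctan (p s / c) + c * s) has_real_derivative
        inverse (1 + (p s / c)\<^sup>2) * ((k - (p s)\<^sup>2) / c) + c) (at s)"
      using c(1) by (auto intro!: derivative_eq_intros p[OF that])
    have num: "k - (p s)\<^sup>2 = - c\<^sup>2 * (1 + (p s / c)\<^sup>2)"
      using c by (simp add: power_divide distrib_left)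
    have cancel: "inverse q * ((- c\<^sup>2 * q) / c) + c = 0" if "q \<noteq> 0" for q
      using c(1) that by (simp add: power2_eq_square)
    have "((\<lambda>s. arctan (p s / c) + c * s) has_real_derivative 0) (at s)"
      using deriv unfolding num cancel[OF pos] .
    then show ?thesis .
  qed
  then obtain a where a: "\<And>s. s \<in> I \<Longrightarrow> arctan (p s / c) + c * s = a"
    using zero_derivative_const[OF I(2), of "\<lambda>s. arctan (p s / c) + c * s"] by blast
  have "cos (c * s + - a) \<noteq> 0 \<and> p s = - c * tan (c * s + - a)" if "s \<in> I" for s
  proof -
    have eq: "c * s + - a = - arctan (p s / c)"
      using a[OF that] by simp
    have "cos (arctan (p s / c)) \<noteq> 0"
      using cos_arctan_not_zero by blast
    then show ?thesis
      unfolding eq using c(1) by (simp add: tan_arctan)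
  qed
  then have ?tan by blast
  then show ?thesis by iprover
next
  case False
  define c where "c = sqrt k"
  have c: "c \<ge> 0" "k = c\<^sup>2"
    using False by (auto simp: c_def)
  show ?thesis
  proof (cases "\<exists>s0\<in>I. p s0 = c")
    case True
    then have "p s = c" if "s \<in> I" for s
      using riccati_stationary[OF I _ _ _ that, of _ p c] p by (auto simp: c(2))
    \<comment> \<open>For \<open>c > 0\<close> the solution \<open>p = c\<close> is only the limit \<open>\<kappa> \<rightarrow> \<infinity>\<close> of the exponential family for \<open>c\<close>,
      but the member \<open>\<kappa> = 0\<close> of the family for \<open>- c\<close>.\<close>
    then have "\<forall>s\<in>I. 1 + 0 * exp (2 * (-c) * s) \<noteq> 0 \<and>
       p s = - ((-c) * (1 - 0 * exp (2 * (-c) * s)) / (1 + 0 * exp (2 * (-c) * s)))"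
      by simp
    then have ?exp by blast
    then show ?thesis by iprover
  next
    case False
    then have ne: "p s - c \<noteq> 0" if "s \<in> I" for s
      using that by auto
    show ?thesis
    proof (cases "c = 0")
      case True
      have "((\<lambda>s. 1 / p s - s) has_real_derivative 0) (at s)" if "s \<in> I" for s
        using ne[OF that]
        by (auto intro!: derivative_eq_intros p[OF that] simp: c(2) True power2_eq_square)
      then obtain a where a: "\<And>s. s \<in> I \<Longrightarrow> 1 / p s - s = a"
        using zero_derivative_const[OF I(2), of "\<lambda>s. 1 / p s - s"] by blast
      have "s + a \<noteq> 0 \<and> p s = 1 / (s + a)" if "s \<in> I" for s
        using a[OF that, symmetric] ne[OF that] True by simp
      then have ?rational by blast
      then show ?thesis by iprover
    next
      case False
      then have c0: "c > 0"
        using c(1) by simp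
      have "((\<lambda>s. (p s + c) / (p s - c) * exp (- 2 * c * s)) has_real_derivative 0) (at s)"
        if "s \<in> I" for s
      proof -
        have "((\<lambda>s. (p s + c) / (p s - c)) has_real_derivative
            ((k - (p s)\<^sup>2) * (p s - c) - (p s + c) * (k - (p s)\<^sup>2)) / ((p s - c) * (p s - c))) (at s)"
          using ne[OF that] by (auto intro!: derivative_eq_intros p[OF that])
        moreover have "(k - (p s)\<^sup>2) * (p s - c) - (p s + c) * (k - (p s)\<^sup>2)
            = (p s + c) * (2 * c) * (p s - c)"
          unfolding c(2) by (simp add: algebra_simps power2_eq_square)
        ultimately have "((\<lambda>s. (p s + c) / (p s - c)) has_real_derivative
            (p s + c) / (p s - c) * (2 * c)) (at s)"
          using ne[OF that] by simp
        moreover have "((\<lambda>s. exp (- 2 * c * s)) has_real_derivative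
            - 2 * c * exp (- 2 * c * s)) (at s)"
          by (auto intro!: derivative_eq_intros)
        ultimately show ?thesis
          by (rule DERIV_mult[THEN DERIV_cong]) simp
      qed
      then obtain a where a: "\<And>s. s \<in> I \<Longrightarrow> (p s + c) / (p s - c) * exp (- 2 * c * s) = a"
        using zero_derivative_const[OF I(2), of "\<lambda>s. (p s + c) / (p s - c) * exp (- 2 * c * s)"] by blast
      have "1 + - a * exp (2 * c * s) \<noteq> 0 \<and>
          p s = - (c * (1 - - a * exp (2 * c * s)) / (1 + - a * exp (2 * c * s)))"
        if "s \<in> I" for s
      proof -
        have "exp (- 2 * c * s) * exp (2 * c * s) = 1"
          by (simp flip: exp_add)
        then have v: "a * exp (2 * c * s) = (p s + c) / (p s - c)"
          using a[OF that, symmetric] by (simp add: mult.assoc)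
        have "1 + - a * exp (2 * c * s) = - 2 * c / (p s - c)"
          "1 - - a * exp (2 * c * s) = 2 * p s / (p s - c)"
          using ne[OF that] by (simp_all add: v divide_simps)
        then show ?thesis
          using ne[OF that] c0 by simp
      qed
      then have ?exp by blast
      then show ?thesis by iprover
    qed
  qed
qed

text \<open>On the whole line, \<open>1 / (s + \<kappa>)\<close> has a pole, and so has the tangent unless \<open>c = 0\<close>, when it is the
  zero solution, which also belongs to the exponential family.\<close>

lemma riccati_solutions_global:
  fixes p :: "real \<Rightarrow> real"
  assumes "(\<exists>\<kappa>. \<forall>s. s + \<kappa> \<noteq> 0 \<and> p s = 1 / (s + \<kappa>)) \<or>
    (\<exists>c \<kappa>. \<forall>s. cos (c * s + \<kappa>) \<noteq> 0 \<and> p s = - c * tan (c * s + \<kappa>)) \<or>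
    (\<exists>c \<kappa>. \<forall>s. 1 + \<kappa> * exp (2 * c * s) \<noteq> 0 \<and>
       p s = - (c * (1 - \<kappa> * exp (2 * c * s)) / (1 + \<kappa> * exp (2 * c * s))))"
  shows "\<exists>c \<kappa>. \<forall>s. 1 + \<kappa> * exp (2 * c * s) \<noteq> 0 \<and>
       p s = - (c * (1 - \<kappa> * exp (2 * c * s)) / (1 + \<kappa> * exp (2 * c * s)))"
  using assms
proof (elim disjE)
  assume "\<exists>\<kappa>. \<forall>s. s + \<kappa> \<noteq> 0 \<and> p s = 1 / (s + \<kappa>)"
  then obtain \<kappa> where *: "\<forall>s. s + \<kappa> \<noteq> 0 \<and> p s = 1 / (s + \<kappa>)" by blast
  from *[rule_format, of "- \<kappa>"] show ?thesis by simp
next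
  assume "\<exists>c \<kappa>. \<forall>s. cos (c * s + \<kappa>) \<noteq> 0 \<and> p s = - c * tan (c * s + \<kappa>)"
  then obtain c \<kappa> where *: "\<And>s. cos (c * s + \<kappa>) \<noteq> 0" "\<And>s. p s = - c * tan (c * s + \<kappa>)"
    by auto
  have "c = 0"
    using *(1)[of "(pi / 2 - \<kappa>) / c"] by (cases "c = 0") auto
  then show ?thesis
    using *(2) by (auto intro!: exI[of _ 0])
qed


section \<open>The tangent bundle\<close>

text \<open>Stated for families of injective charts, so that it applies to the charts of \<open>TM\<close>: these are
  injective because the components of a vector in one chart determine those in all others.
  Injectivity makes the coordinate image of an intersection the intersection of the images, so that
  the sets with open images are closed under intersection.\<close>

lemma openin_atlas_topology_inj:
  assumes inj: "\<And>c. c \<in> A \<Longrightarrow> inj_on (snd c) (fst c)"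
  shows "openin (atlas_topology M A) W \<longleftrightarrow> W \<subseteq> M \<and> (\<forall>c\<in>A. open (snd c ` (W \<inter> fst c)))"
proof -
  have "istopology (\<lambda>W. W \<subseteq> M \<and> (\<forall>c\<in>A. open (snd c ` (W \<inter> fst c))))"
    unfolding istopology_def
  proof (intro conjI allI impI ballI)
    fix S T c
    assume S: "S \<subseteq> M \<and> (\<forall>c\<in>A. open (snd c ` (S \<inter> fst c)))"
      and T: "T \<subseteq> M \<and> (\<forall>c\<in>A. open (snd c ` (T \<inter> fst c)))" and c: "c \<in> A"
    have "snd c ` (S \<inter> T \<inter> fst c) = snd c ` (S \<inter> fst c) \<inter> snd c ` (T \<inter> fst c)"
      using inj_on_image_Int[OF inj[OF c], of "S \<inter> fst c" "T \<inter> fst c"]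
      by (simp add: Int_ac)
    then show "open (snd c ` (S \<inter> T \<inter> fst c))"
      using S T c by auto
  next
    fix K c
    assume K: "\<forall>S\<in>K. S \<subseteq> M \<and> (\<forall>c\<in>A. open (snd c ` (S \<inter> fst c)))" and c: "c \<in> A"
    have "snd c ` (\<Union>K \<inter> fst c) = (\<Union>S\<in>K. snd c ` (S \<inter> fst c))"
      by auto
    then show "open (snd c ` (\<Union>K \<inter> fst c))"
      using K c by auto
  qed auto
  then show ?thesis
    by (simp add: atlas_topology_def topology_inverse')
qed

lemma snd_tangent_chart [simp]: "snd (tangent_chart M A c) w = (snd c (fst w), snd w c)"
  by (simp add: tangent_chart_def)

lemma mem_tangent_chart: "w \<in> fst (tangent_chart M A c) \<longleftrightarrow> w \<in> tangent_bundle M A \<and> fst w \<in> fst c"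
  by (simp add: tangent_chart_def)

lemma tangent_space_outside: "v \<in> tangent_space A p \<Longrightarrow> c \<notin> A \<or> p \<notin> fst c \<Longrightarrow> v c = 0"
  unfolding tangent_space_def by blast

lemma tangent_space_transition:
  "v \<in> tangent_space A p \<Longrightarrow> c \<in> A \<Longrightarrow> d \<in> A \<Longrightarrow> p \<in> fst c \<Longrightarrow> p \<in> fst d \<Longrightarrow>
    v d = frechet_derivative (transition c d) (at (snd c p)) (v c)"
  unfolding tangent_space_def by blast

lemma tangent_bundle_snd: "w \<in> tangent_bundle M A \<Longrightarrow> snd w \<in> tangent_space A (fst w)"
  by (auto simp: tangent_bundle_def)

lemma inj_on_tangent_chart:
  assumes "smooth_atlas M A" "c \<in> A"
  shows "inj_on (snd (tangent_chart M A c)) (fst (tangent_chart M A c))"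
proof (rule inj_onI)
  fix v w assume vw: "v \<in> fst (tangent_chart M A c)" "w \<in> fst (tangent_chart M A c)"
    "snd (tangent_chart M A c) v = snd (tangent_chart M A c) w"
  have "inj_on (snd c) (fst c)"
    using assms by (auto simp: smooth_atlas_def is_chart_def)
  then have p: "fst v = fst w" and y: "snd v c = snd w c"
    using vw by (auto simp: mem_tangent_chart inj_on_eq_iff)
  have v: "snd v \<in> tangent_space A (fst v)" and w: "snd w \<in> tangent_space A (fst v)"
    and "fst v \<in> fst c"
    using vw(1,2) tangent_bundle_snd p by (metis mem_tangent_chart)+
  then have "snd v d = snd w d" for d
    using tangent_space_outside[OF v, of d] tangent_space_outside[OF w, of d] y assms(2)
      tangent_space_transition[OF v, of c d] tangent_space_transition[OF w, of c d]
    by metis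
  then show "v = w"
    using p by (simp add: prod_eq_iff fun_eq_iff del: split_paired_All)
qed

lemma openin_tangent_bundle:
  assumes "smooth_atlas M A"
  shows "openin (atlas_topology (tangent_bundle M A) (tangent_atlas M A)) W \<longleftrightarrow>
    W \<subseteq> tangent_bundle M A \<and>
    (\<forall>c\<in>A. open (snd (tangent_chart M A c) ` (W \<inter> fst (tangent_chart M A c))))"
proof -
  have "inj_on (snd c) (fst c)" if "c \<in> tangent_atlas M A" for c :: "(('a, 'b) tvec, 'b \<times> 'b) chart"
    using that inj_on_tangent_chart[OF assms] unfolding tangent_atlas_def by (elim imageE) simp
  from openin_atlas_topology_inj[OF this, where M = "tangent_bundle M A"]
  show ?thesis
    by (simp only: tangent_atlas_def ball_simps)
qed

lemma fun_in_chart: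
  assumes "smooth_atlas M A" "c \<in> A" "w \<in> tangent_bundle M A" "fst w \<in> fst c"
  shows "fun_in M A f c (snd c (fst w), snd w c) = f w"
  using inv_into_f_f[OF inj_on_tangent_chart[OF assms(1,2)], of w] assms(3,4)
  by (simp add: fun_in_def chart_inv_def mem_tangent_chart)

text \<open>Excludes \<open>y = 0\<close> in every chart from the fact that the conical region avoids the zero section: the
  components of a vector in two charts differ by a linear map.\<close>

lemma tangent_space_eq_0:
  assumes A: "smooth_atlas M A" and c: "c \<in> A" "p \<in> fst c"
    and v: "v \<in> tangent_space A p" "v c = 0"
  shows "v = (\<lambda>c. 0)"
proof
  fix d
  show "v d = 0"
  proof (cases "d \<in> A \<and> p \<in> fst d")
    case True
    then have "smooth_on (transition c d) (snd c ` (fst c \<inter> fst d))"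
      using A c by (auto simp: smooth_atlas_def compatible_def)
    then have "Ck_on (Suc 0) (transition c d) (snd c ` (fst c \<inter> fst d))"
      by (simp add: smooth_on_def)
    then have "transition c d differentiable at (snd c p)"
      using True c by auto
    from linear_0[OF linear_frechet_derivative[OF this]] show ?thesis
      using tangent_space_transition[OF v(1), of c d] v(2) True c by simp
  next
    case False
    then show ?thesis
      using tangent_space_outside[OF v(1)] by blast
  qed
qed

lemma region_inE:
  assumes "z \<in> region_in M A C c" "C \<subseteq> tangent_bundle M A"
  obtains w where "w \<in> C" "w \<in> tangent_bundle M A" "fst w \<in> fst c" "z = (snd c (fst w), snd w c)"
  using assms by (auto simp: region_in_def mem_tangent_chart)

lemma region_inI:
  assumes "w \<in> C" "C \<subseteq> tangent_bundle M A" "fst w \<in> fst c"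
  shows "(snd c (fst w), snd w c) \<in> region_in M A C c"
  using assms by (force simp: region_in_def mem_tangent_chart)

section \<open>Sprays on manifolds in charts\<close>

lemma spray_region_subset: "spray M A C X \<Longrightarrow> C \<subseteq> tangent_bundle M A"
  by (auto simp: spray_def conical_region_def)

lemma spray_imp_local_spray:
  fixes A :: "('p, real^'n) chart set"
  assumes A: "smooth_atlas M A" and X: "spray M A C X" and c: "c \<in> A"
  shows "local_spray (region_in M A C c) (spray_coeff M A X c)"
proof
  let ?\<Omega> = "region_in M A C c" and ?tc = "tangent_chart M A c"
  define F where "F = (\<lambda>z. X (chart_inv ?tc z) ?tc)"
  have C: "conical_region M A C"
    using X by (simp add: spray_def)
  then have sub: "C \<subseteq> tangent_bundle M A"
    by (auto simp: conical_region_def)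
  show op: "open ?\<Omega>"
    using C c openin_tangent_bundle[OF A] by (simp add: conical_region_def region_in_def)
  show "snd z \<noteq> 0" if z: "z \<in> ?\<Omega>" for z
  proof -
    obtain w where w: "w \<in> C" "w \<in> tangent_bundle M A" "fst w \<in> fst c" "z = (snd c (fst w), snd w c)"
      using region_inE[OF z sub] .
    have "snd w \<noteq> (\<lambda>c. 0)"
      using C w(1) by (auto simp: conical_region_def)
    moreover have "snd w \<in> tangent_space A (fst w)"
      using w(2) by (rule tangent_bundle_snd)
    ultimately show ?thesis
      using tangent_space_eq_0[OF A c w(3)] w(4) by auto
  qed
  show "(x, t *\<^sub>R y) \<in> ?\<Omega>" if z: "(x, y) \<in> ?\<Omega>" and t: "t > 0" for x y and t :: real
  proof -
    obtain w where w: "w \<in> C" "fst w \<in> fst c" "(x, y) = (snd c (fst w), snd w c)"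
      using region_inE[OF z sub] .
    have "(fst w, \<lambda>c. t *\<^sub>R snd w c) \<in> C"
      using C w(1) t unfolding conical_region_def by blast
    from region_inI[OF this sub, of c] show ?thesis
      using w by simp
  qed
  show "spray_coeff M A X c (x, t *\<^sub>R y) = t\<^sup>2 *\<^sub>R spray_coeff M A X c (x, y)"
    if "(x, y) \<in> ?\<Omega>" "t > 0" for x y and t :: real
    using X c that unfolding spray_def by blast
  have "smooth_on F ?\<Omega>"
    using X c by (auto simp: spray_def vector_field_on_def F_def region_in_def tangent_atlas_def)
  then have F: "Ck_on (Suc (Suc 0)) F ?\<Omega>"
    by (simp add: smooth_on_def)
  have coeff: "spray_coeff M A X c = (\<lambda>z. - (1/2) *\<^sub>R snd (F z))"
    by (simp add: spray_coeff_def fun_in_def F_def fun_eq_iff)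
  have lin: "bounded_linear (\<lambda>u :: (real^'n) \<times> (real^'n). - (1/2) *\<^sub>R snd u)"
    by (intro bounded_linear_intros)
  have D: "(spray_coeff M A X c has_derivative (\<lambda>b. - (1/2) *\<^sub>R snd (frechet_derivative F (at z) b))) (at z)"
    if "z \<in> ?\<Omega>" for z
    unfolding coeff using F that
    by (intro bounded_linear.has_derivative[OF lin]) (simp add: frechet_derivative_works)
  show "spray_coeff M A X c differentiable at z" if "z \<in> ?\<Omega>" for z
    using D[OF that] by (rule differentiableI)
  show "(\<lambda>w. frechet_derivative (spray_coeff M A X c) (at w) b) differentiable at z"
    if z: "z \<in> ?\<Omega>" and b: "b \<in> Basis" for z b
  proof -
    have "((\<lambda>w. - (1/2) *\<^sub>R snd (frechet_derivative F (at w) b)) has_derivative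
        (\<lambda>h. - (1/2) *\<^sub>R snd (frechet_derivative (\<lambda>w. frechet_derivative F (at w) b) (at z) h))) (at z)"
      using F z b
      by (intro bounded_linear.has_derivative[OF lin]) (simp add: frechet_derivative_works)
    moreover have "- (1/2) *\<^sub>R snd (frechet_derivative F (at w) b) =
        frechet_derivative (spray_coeff M A X c) (at w) b" if "w \<in> ?\<Omega>" for w
      by (simp add: frechet_derivative_eqI[OF D[OF that]])
    ultimately show ?thesis
      by (rule differentiableI[OF has_derivative_transform_within_open[OF _ op z]])
  qed
qed

lemma constant_curvature_weakly_Ricci_constant:
  fixes A :: "('p, real^'n) chart set"
  assumes A: "smooth_atlas M A" and X: "spray M A C X" and cc: "constant_curvature M A C X"
  shows "weakly_Ricci_constant M A C X"
proof -
  obtain R :: "('p, real^'n) tvec \<Rightarrow> real" and \<tau> where "covector_on A C \<tau> \<and>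
    (\<forall>c\<in>A. \<forall>z \<in> region_in M A C c.
       (let G = spray_coeff M A X c; T = (\<lambda>z. fun_in M A \<tau> c z c) in
          (\<forall>i k. riemann G i k z =
             fun_in M A R c z * (if i = k then 1 else 0) - T z $ k * snd z $ i) \<and>
          T differentiable (at z) \<and>
          (\<forall>i k. hd_cov G i k T z = 0)))"
    using cc unfolding constant_curvature_def by (elim exE) (rule that)
  note * = this[THEN conjunct2, unfolded Let_def]
  show ?thesis
    unfolding weakly_Ricci_constant_def Let_def
  proof (intro ballI)
    fix c z assume c: "c \<in> A" and z: "z \<in> region_in M A C c"
    interpret local_spray "region_in M A C c" "spray_coeff M A X c"
      using A X c by (rule spray_imp_local_spray)
    show "(\<Sum>r\<in>UNIV. hd_fun (spray_coeff M A X c) r (ricci (spray_coeff M A X c)) z * snd z $ r) = 0"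
    proof (rule constant_curvature_imp_weakly_Ricci_constant[OF _ z])
      show "riemann (spray_coeff M A X c) i k w =
          fun_in M A R c w * (if i = k then 1 else 0) - fun_in M A \<tau> c w c $ k * snd w $ i"
        if "w \<in> region_in M A C c" for w i k
        using * c that by blast
      show "(\<lambda>z. fun_in M A \<tau> c z c) differentiable (at z)"
        using * c z by blast
      show "hd_cov (spray_coeff M A X c) i k (\<lambda>z. fun_in M A \<tau> c z c) z = 0" for i k
        using * c z by blast
    qed
  qed
qed

section \<open>Geodesics in charts\<close>

context
  fixes M :: "'p set" and A :: "('p, real^'n) chart set" and C X I \<sigma>
  assumes A: "smooth_atlas M A" and X: "spray M A C X" and I: "open I"
    and \<sigma>: "integral_curve (tangent_bundle M A) (tangent_atlas M A) C X I \<sigma>"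
begin

lemma integral_curve_mem: "s \<in> I \<Longrightarrow> \<sigma> s \<in> C"
  using \<sigma> by (simp add: integral_curve_def)

lemma integral_curve_in_chart:
  assumes c: "c \<in> A" and s: "s \<in> I" "fst (\<sigma> s) \<in> fst c"
  shows "((\<lambda>t. (snd c (fst (\<sigma> t)), snd (\<sigma> t) c)) has_vector_derivative
    (snd (\<sigma> s) c, - 2 *\<^sub>R spray_coeff M A X c (snd c (fst (\<sigma> s)), snd (\<sigma> s) c))) (at s)"
proof -
  let ?tc = "tangent_chart M A c" and ?z = "(snd c (fst (\<sigma> s)), snd (\<sigma> s) c)"
  have tc: "?tc \<in> tangent_atlas M A"
    using c by (simp add: tangent_atlas_def)
  have w: "\<sigma> s \<in> tangent_bundle M A"
    using integral_curve_mem[OF s(1)] spray_region_subset[OF X] by auto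
  then have dom: "\<sigma> s \<in> fst ?tc"
    using s(2) by (simp add: mem_tangent_chart)
  have "(snd ?tc \<circ> \<sigma>) differentiable at s"
    using \<sigma> s(1) tc dom by (simp add: integral_curve_def differentiable_curve_def)
  then have "((snd ?tc \<circ> \<sigma>) has_vector_derivative vector_derivative (snd ?tc \<circ> \<sigma>) (at s)) (at s)"
    by (simp add: vector_derivative_works)
  also have "vector_derivative (snd ?tc \<circ> \<sigma>) (at s) = velocity (tangent_atlas M A) \<sigma> s ?tc"
    using tc dom by (simp add: velocity_def)
  also have "\<dots> = fun_in M A X c ?z ?tc"
    using \<sigma> s(1) fun_in_chart[OF A c w s(2), of X] by (simp add: integral_curve_def)
  also have "\<dots> = (snd (\<sigma> s) c, - 2 *\<^sub>R spray_coeff M A X c ?z)"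
  proof (rule prod_eqI)
    have "?z \<in> region_in M A C c"
      using region_inI[OF integral_curve_mem[OF s(1)] spray_region_subset[OF X] s(2)] .
    then show "fst (fun_in M A X c ?z ?tc) = fst (snd (\<sigma> s) c, - 2 *\<^sub>R spray_coeff M A X c ?z)"
      using X c by (auto simp: spray_def)
  qed (simp add: spray_coeff_def)
  finally show ?thesis
    by (simp add: o_def)
qed

text \<open>The integral curve of the spray on \<open>TM\<close> is the canonical lift of its projection: the first
  component \<open>y\<close> of the spray forces the fibre coordinate to be the velocity. The components in
  charts away from the point vanish on both sides by convention.\<close>

lemma velocity_of_projection:
  assumes \<gamma>: "\<And>t. t \<in> I \<Longrightarrow> \<gamma> t = fst (\<sigma> t)" and s: "s \<in> I"
  shows "velocity A \<gamma> s = snd (\<sigma> s)"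
proof
  fix c
  show "velocity A \<gamma> s c = snd (\<sigma> s) c"
  proof (cases "c \<in> A \<and> \<gamma> s \<in> fst c")
    case True
    then have "((\<lambda>t. (snd c (fst (\<sigma> t)), snd (\<sigma> t) c)) has_vector_derivative
      (snd (\<sigma> s) c, - 2 *\<^sub>R spray_coeff M A X c (snd c (fst (\<sigma> s)), snd (\<sigma> s) c))) (at s)"
      using s \<gamma> by (intro integral_curve_in_chart) auto
    from bounded_linear.has_vector_derivative[OF bounded_linear_fst this]
    have "((\<lambda>t. snd c (fst (\<sigma> t))) has_vector_derivative snd (\<sigma> s) c) (at s)"
      by simp
    then have "((snd c \<circ> \<gamma>) has_vector_derivative snd (\<sigma> s) c) (at s)"
      by (rule has_vector_derivative_transform_within_open[OF _ I s]) (simp add: \<gamma>)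
    then show ?thesis
      using True by (simp add: velocity_def vector_derivative_at)
  next
    case False
    moreover have "snd (\<sigma> s) \<in> tangent_space A (fst (\<sigma> s))"
      using integral_curve_mem[OF s] spray_region_subset[OF X] by (intro tangent_bundle_snd) auto
    ultimately show ?thesis
      using \<gamma>[OF s] tangent_space_outside[of "snd (\<sigma> s)" A "fst (\<sigma> s)" c]
      by (auto simp: velocity_def)
  qed
qed

text \<open>The part of the conical region over a chart domain is open in \<open>TM\<close>: in the coordinates of
  another chart it is the region cut with an open cylinder. Continuity of the curve then gives a
  neighbourhood of \<open>s\<close>.\<close>

lemma integral_curve_stays_in_chart:
  assumes c: "c \<in> A" and s: "s \<in> I" "fst (\<sigma> s) \<in> fst c"
  shows "\<exists>J. open J \<and> s \<in> J \<and> J \<subseteq> I \<and> (\<forall>t\<in>J. fst (\<sigma> t) \<in> fst c)"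
proof -
  let ?T = "atlas_topology (tangent_bundle M A) (tangent_atlas M A)"
  define W where "W = C \<inter> {w. fst w \<in> fst c}"
  have "openin ?T W"
    unfolding openin_tangent_bundle[OF A]
  proof (intro conjI ballI)
    show "W \<subseteq> tangent_bundle M A"
      using spray_region_subset[OF X] by (auto simp: W_def)
    fix d assume d: "d \<in> A"
    let ?td = "tangent_chart M A d" and ?U = "snd d ` (fst c \<inter> fst d)"
    have inj: "inj_on (snd d) (fst d)"
      using A d by (auto simp: smooth_atlas_def is_chart_def)
    have "snd ?td ` (W \<inter> fst ?td) = region_in M A C d \<inter> (?U \<times> UNIV)"
    proof (intro set_eqI iffI)
      fix z assume "z \<in> region_in M A C d \<inter> (?U \<times> UNIV)"
      then obtain w where "w \<in> C" "w \<in> tangent_bundle M A" "fst w \<in> fst d"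
        "z = (snd d (fst w), snd w d)" "snd d (fst w) \<in> ?U"
        using region_inE[OF _ spray_region_subset[OF X]] by (metis IntE mem_Times_iff fst_conv)
      moreover from this have "fst w \<in> fst c"
        using inj by (auto simp: inj_on_eq_iff)
      ultimately show "z \<in> snd ?td ` (W \<inter> fst ?td)"
        by (auto simp: W_def mem_tangent_chart intro!: image_eqI[of _ _ w])
    qed (auto simp: W_def mem_tangent_chart region_in_def)
    moreover have "open (region_in M A C d)"
      using spray_imp_local_spray[OF A X d] by (rule local_spray.open_region)
    moreover have "open ?U"
      using A c d by (auto simp: smooth_atlas_def compatible_def)
    ultimately show "open (snd ?td ` (W \<inter> fst ?td))"
      by (auto intro: open_Times)
  qed
  moreover have "continuous_map (top_of_set I) ?T \<sigma>"
    using \<sigma> by (simp add: integral_curve_def differentiable_curve_def)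
  ultimately have "openin (top_of_set I) {t \<in> I. \<sigma> t \<in> W}"
    using openin_continuous_map_preimage[of "top_of_set I" ?T \<sigma> W] by simp
  then have "open {t \<in> I. \<sigma> t \<in> W}"
    using I openin_open_eq by blast
  then show ?thesis
    using s integral_curve_mem[OF s(1)]
    by (intro exI[of _ "{t \<in> I. \<sigma> t \<in> W}"]) (auto simp: W_def)
qed

end


section \<open>The projective factor along geodesics\<close>

text \<open>Around each parameter value there is a flat chart, in which \<open>P' + P\<^sup>2 = - \<Xi>\<close> and \<open>\<Xi>\<close> is constant
  along the geodesic. The flat chart changes along the geodesic, and with it the coordinate expression of
  \<open>\<Xi>\<close>, but \<open>q = P' + P\<^sup>2\<close> does not refer to a chart. So \<open>q\<close> is defined on all of \<open>I\<close>, has derivative zero, and is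
  constant as \<open>I\<close> is an interval.\<close>

lemma riccati_along_geodesic:
  fixes M :: "'p set" and A :: "('p, real^'n) chart set" and P :: "('p, real^'n) tvec \<Rightarrow> real"
  assumes n: "CARD('n) \<ge> 2" and A: "smooth_atlas M A"
    and flat: "locally_Minkowski M A C Gt" and X: "spray M A C X"
    and proj: "projectively_related M A C Gt X P"
    and ric: "weakly_Ricci_constant M A C X"
    and \<gamma>: "geodesic M A C X I \<gamma>"
  shows "\<exists>k. \<forall>s\<in>I. ((\<lambda>s. P (\<gamma> s, velocity A \<gamma> s)) has_real_derivative
    k - (P (\<gamma> s, velocity A \<gamma> s))\<^sup>2) (at s)"
proof -
  let ?p = "\<lambda>s. P (\<gamma> s, velocity A \<gamma> s)"
  obtain \<sigma> where I: "open I" "is_interval I"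
    and \<sigma>: "integral_curve (tangent_bundle M A) (tangent_atlas M A) C X I \<sigma>"
    and \<gamma>\<sigma>: "\<And>s. s \<in> I \<Longrightarrow> \<gamma> s = fst (\<sigma> s)"
    using \<gamma> unfolding geodesic_def by blast
  have sub: "C \<subseteq> tangent_bundle M A"
    using X by (rule spray_region_subset)
  have p: "?p s = P (\<sigma> s)" if "s \<in> I" for s
    using velocity_of_projection[OF A X I(1) \<sigma> \<gamma>\<sigma> that] \<gamma>\<sigma>[OF that] by simp
  define q where "q = (\<lambda>s. deriv ?p s + (?p s)\<^sup>2)"
  have "(?p has_real_derivative deriv ?p s) (at s) \<and> (q has_real_derivative 0) (at s)"
    if s: "s \<in> I" for s
  proof -
    have \<sigma>C: "\<sigma> t \<in> C" if "t \<in> I" for t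
      using integral_curve_mem[OF A X I(1) \<sigma> that] .
    have "fst (\<sigma> s) \<in> M"
      using \<sigma>C[OF s] sub by (auto simp: tangent_bundle_def)
    then obtain c where c: "c \<in> A" "fst (\<sigma> s) \<in> fst c"
      and 0: "\<And>z. z \<in> region_in M A C c \<Longrightarrow> spray_coeff M A Gt c z = 0"
      using flat unfolding locally_Minkowski_def by blast
    define z where "z = (\<lambda>t. (snd c (fst (\<sigma> t)), snd (\<sigma> t) c))"
    interpret local_spray "region_in M A C c" "spray_coeff M A X c"
      using A X c(1) by (rule spray_imp_local_spray)
    interpret projectively_flat_spray "region_in M A C c" "spray_coeff M A X c" "fun_in M A P c"
      using proj c(1) 0 by unfold_locales (simp add: projectively_related_def)
    obtain J where J: "open J" "s \<in> J" "J \<subseteq> I" "\<And>t. t \<in> J \<Longrightarrow> fst (\<sigma> t) \<in> fst c"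
      using integral_curve_stays_in_chart[OF A X I(1) \<sigma> c(1) s c(2)] by blast
    have z: "z t \<in> region_in M A C c" if "t \<in> J" for t
      using region_inI[OF \<sigma>C sub J(4)] that J(3) by (auto simp: z_def)
    have z': "(z has_vector_derivative (snd (z t), - 2 *\<^sub>R spray_coeff M A X c (z t))) (at t)"
      if "t \<in> J" for t
      using integral_curve_in_chart[OF A X I(1) \<sigma> c(1) _ J(4)[OF that]] that J(3)
      by (auto simp: z_def)
    have pz: "fun_in M A P c (z t) = ?p t" if "t \<in> J" for t
      using fun_in_chart[OF A c(1) subsetD[OF sub \<sigma>C] J(4)[OF that], of P] p[of t] that J(3)
      by (auto simp: z_def)
    have dp: "(?p has_real_derivative - \<Xi> (z t) - (?p t)\<^sup>2) (at t)" if "t \<in> J" for t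
      using has_field_derivative_transform_within_open[OF P_along_geodesic[of z t, OF z[OF that] z'[OF that]] J(1) that pz]
      by (simp add: pz[OF that])
    have "q t = - \<Xi> (z t)" if "t \<in> J" for t
      using DERIV_imp_deriv[OF dp[OF that]] by (simp add: q_def)
    then have q: "- \<Xi> (z t) = q t" if "t \<in> J" for t
      using that by simp
    have "((\<lambda>t. \<Xi> (z t)) has_real_derivative 0) (at s)"
      using ric c(1) z[OF J(2)]
      by (intro \<Xi>_along_geodesic[OF _ z'[OF J(2)] n])
        (auto simp: weakly_Ricci_constant_def Let_def)
    then have "((\<lambda>t. - \<Xi> (z t)) has_real_derivative 0) (at s)"
      using DERIV_minus by fastforce
    then have "(q has_real_derivative 0) (at s)"
      by (rule has_field_derivative_transform_within_open[OF _ J(1,2) q])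
    moreover have "(?p has_real_derivative deriv ?p s) (at s)"
      using dp[OF J(2)] DERIV_imp_deriv[OF dp[OF J(2)]] by simp
    ultimately show ?thesis by blast
  qed
  note * = this
  obtain k where k: "\<And>s. s \<in> I \<Longrightarrow> q s = k"
    using zero_derivative_const[OF I(2), of q] * by blast
  have "(?p has_real_derivative k - (?p s)\<^sup>2) (at s)" if "s \<in> I" for s
    using *[OF that] k[OF that] by (auto simp: q_def)
  then show ?thesis by blast
qed

theorem theorem1p1:
  fixes M :: "'p set" and A :: "('p, real^'n) chart set"
    and C :: "('p, real^'n) tvec set"
    and Gt G :: "('p, real^'n) tm_field"
    and P :: "('p, real^'n) tvec \<Rightarrow> real"
  assumes "CARD('n) \<ge> 2"
    and "smooth_manifold M A"
    and "locally_Minkowski M A C Gt"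
    and "spray M A C G"
    and "projectively_related M A C Gt G P"
    and "weakly_Ricci_constant M A C G \<or> constant_curvature M A C G"
  shows "(\<forall>I \<gamma>. geodesic M A C G I \<gamma> \<longrightarrow>
            (\<exists>\<kappa>. \<forall>s\<in>I. s + \<kappa> \<noteq> 0 \<and>
               P (\<gamma> s, velocity A \<gamma> s) = 1 / (s + \<kappa>)) \<or>
            (\<exists>c \<kappa>. \<forall>s\<in>I. cos (c * s + \<kappa>) \<noteq> 0 \<and>
               P (\<gamma> s, velocity A \<gamma> s) = - c * tan (c * s + \<kappa>)) \<or>
            (\<exists>c \<kappa>. \<forall>s\<in>I. 1 + \<kappa> * exp (2 * c * s) \<noteq> 0 \<and>
               P (\<gamma> s, velocity A \<gamma> s) =
                 - (c * (1 - \<kappa> * exp (2 * c * s)) / (1 + \<kappa> * exp (2 * c * s)))))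
       \<and> (complete_spray M A C G \<longrightarrow>
            (\<forall>I \<gamma>. geodesic M A C G I \<gamma> \<longrightarrow>
              (\<exists>c \<kappa>. \<forall>s\<in>I. 1 + \<kappa> * exp (2 * c * s) \<noteq> 0 \<and>
                 P (\<gamma> s, velocity A \<gamma> s) =
                   - (c * (1 - \<kappa> * exp (2 * c * s)) / (1 + \<kappa> * exp (2 * c * s))))))"
    (is "?local \<and> (?complete \<longrightarrow> ?global)")
proof -
  have A: "smooth_atlas M A"
    using assms(2) by (simp add: smooth_manifold_def)
  have ric: "weakly_Ricci_constant M A C G"
    using assms(6) constant_curvature_weakly_Ricci_constant[OF A assms(4)] by blast
  have forms: "(\<exists>\<kappa>. \<forall>s\<in>I. s + \<kappa> \<noteq> 0 \<and> P (\<gamma> s, velocity A \<gamma> s) = 1 / (s + \<kappa>)) \<or>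
      (\<exists>c \<kappa>. \<forall>s\<in>I. cos (c * s + \<kappa>) \<noteq> 0 \<and> P (\<gamma> s, velocity A \<gamma> s) = - c * tan (c * s + \<kappa>)) \<or>
      (\<exists>c \<kappa>. \<forall>s\<in>I. 1 + \<kappa> * exp (2 * c * s) \<noteq> 0 \<and> P (\<gamma> s, velocity A \<gamma> s) =
         - (c * (1 - \<kappa> * exp (2 * c * s)) / (1 + \<kappa> * exp (2 * c * s))))"
    if \<gamma>: "geodesic M A C G I \<gamma>" for I \<gamma>
  proof -
    obtain k where k: "\<forall>s\<in>I. ((\<lambda>s. P (\<gamma> s, velocity A \<gamma> s)) has_real_derivative
        k - (P (\<gamma> s, velocity A \<gamma> s))\<^sup>2) (at s)"
      using riccati_along_geodesic[OF assms(1) A assms(3-5) ric \<gamma>] by (elim exE)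
    have I: "open I" "is_interval I"
      using \<gamma> by (simp_all add: geodesic_def)
    show ?thesis
      by (rule riccati_solutions[OF I bspec[OF k]])
  qed
  have global: "\<exists>c \<kappa>. \<forall>s\<in>I. 1 + \<kappa> * exp (2 * c * s) \<noteq> 0 \<and> P (\<gamma> s, velocity A \<gamma> s) =
         - (c * (1 - \<kappa> * exp (2 * c * s)) / (1 + \<kappa> * exp (2 * c * s)))"
    if complete: "complete_spray M A C G" and \<gamma>: "geodesic M A C G I \<gamma>" for I \<gamma>
  proof -
    obtain \<gamma>' where \<gamma>': "geodesic M A C G UNIV \<gamma>'" and eq: "\<And>s. s \<in> I \<Longrightarrow> \<gamma>' s = \<gamma> s"
      using complete \<gamma> unfolding complete_spray_def by blast
    obtain c \<kappa> where *: "\<forall>s. 1 + \<kappa> * exp (2 * c * s) \<noteq> 0 \<and> P (\<gamma>' s, velocity A \<gamma>' s) =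
         - (c * (1 - \<kappa> * exp (2 * c * s)) / (1 + \<kappa> * exp (2 * c * s)))"
      using riccati_solutions_global[OF forms[OF \<gamma>', unfolded ball_UNIV]] by (elim exE)
    have "velocity A \<gamma>' s = velocity A \<gamma> s" if s: "s \<in> I" for s
    proof -
      have "eventually (\<lambda>t. \<gamma>' t = \<gamma> t) (nhds s)"
        using eq s \<gamma> unfolding geodesic_def eventually_nhds by blast
      then have "vector_derivative (snd c \<circ> \<gamma>') (at s) = vector_derivative (snd c \<circ> \<gamma>) (at s)"
        for c :: "('p, real^'n) chart"
        by (intro vector_derivative_cong_eq) (auto elim: eventually_mono)
      then show ?thesis
        by (simp add: velocity_def eq[OF s] cong: if_cong)
    qed
    then show ?thesis
      using * eq by (intro exI[of _ c] exI[of _ \<kappa>]) (metis (full_types))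
  qed
  show ?thesis
    using forms global by (intro conjI impI allI)
qed

end
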